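(* There is a surjective algebra morphism \begin{align*} p:\hspace{0,4cm}\mathcal{G}^{\operatorname{f}}\ &\longrightarrow\hspace{1,3cm} \mathcal{Z}^f,\\ \operatorname{f}(w)\ &\longmapsto\sum_{\substack{w=uv \\ u\in\{b_0,b_1\}^*,\ v\in\{b_i\mid i\geq1\}^*}}\zeta^f_{\sqcup\!\sqcup}\left((\theta_\mathcal{X}^{\operatorname{anti}})^{-1}(u)\right)\zeta^f_\ast\left(\theta_\mathcal{Y}^{-1}(v)\right) \qquad (w\in \mathcal{B}^* ). \end{align*}
   Context: Let $\mathcal{B}=\{b_0,b_1,\ldots\}$, $\mathcal{X}=\{x_0,x_1\}$, $\mathcal{Y}=\{y_1,y_2,\ldots\}$, with word sets $\mathcal{B}^*,\mathcal{X}^*,\mathcal{Y}^*$ and free non-commutative polynomial algebras $\mathbb{Q}\langle \mathcal{B}\rangle$, $\mathbb{Q}\langle \mathcal{X}\rangle$, $\mathbb{Q}\langle \mathcal{Y}\rangle$. The balanced quasi-shuffle product $\ast_b$ on $\mathbb{Q}\langle \mathcal{B}\rangle$: $\mathbf{1}\ast_b w=w\ast_b\mathbf{1}=w$, $b_iu\ast_b b_jv=b_i(u\ast_b b_jv)+b_j(b_iu\ast_b v)+b_{i+j}(u\ast_b v)$ if $i,j\geq1$ (last term omitted otherwise). On the span of words not starting with $b_0$, $\tau(b_{k_1}b_0^{m_1}\cdots b_{k_d}b_0^{m_d})=b_{m_d+1}b_0^{k_d-1}\cdots b_{m_1+1}b_0^{k_1-1}$. $\mathcal{G}^{\operatorname{f}}$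 is the quotient of $(\mathbb{Q}\langle \mathcal{B}\rangle,\ast_b)$ by the ideal generated by $b_0$ and all $w-\tau(w)$ ($w$ not starting with $b_0$); $\operatorname{f}(w)$ is the class of $w$. $\mathcal{Z}^f$ is the quotient of $(\mathbb{Q}\langle \mathcal{X}\rangle,\sqcup\!\sqcup)$ ($\sqcup\!\sqcup$ the shuffle product) by the ideal of extended double shuffle relations; $\zeta^f_{\sqcup\!\sqcup}(w)$ is the class of $w\in\mathbb{Q}\langle \mathcal{X}\rangle$ (shuffle regularized formal multiple zeta values), $\zeta^f(n)=\zeta^f_{\sqcup\!\sqcup}(x_0^{n-1}x_1)$, and the stuffle regularized formal multiple zeta values $\zeta^f_\ast(v)$, $v\in\mathcal{Y}^*$, are given by $\sum_{v\in\mathcal{Y}^*}\zeta^f_\ast(v)v=\exp\big(\sum_{n\geq2}\frac{(-1)^{n-1}}{n}\zeta^f(n)y_1^n\big)\sum_{w\in\mathcal{X}^*}\zeta^f_{\sqcup\!\sqcup}(w)\Pi_\mathcal{Y}(w)$, where $\Pi_\mathcal{Y}$ sends words ending in $x_0$ to $0$ and $x_0^{k_1-1}x_1\cdots x_0^{k_d-1}x_1$ to $y_{k_1}\cdots y_{k_d}$. The maps are $\theta_\mathcal{X}^{\operatorname{anti}}(x_{\varepsilon_1}\cdots x_{\varepsilon_n})=b_{\varepsilon_n}\cdots b_{\varepsilon_1}$ and $\theta_\mathcal{Y}(y_{k_1}\cdots y_{k_d})=b_{k_1}\cdots b_{k_d}$, inverted on words in $\{b_0,b_1\}$ resp. $\{b_i\mid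 i\geq1\}$. *)

theory Defs
  imports
    "HOL-Library.Poly_Mapping"
    "HOL-Algebra.QuotRing"
    "HOL-Algebra.Module"
    "HOL-Algebra.Algebraic_Closure_Type"
begin

section \<open>Free non-commutative polynomials\<close>

text \<open>
  The space of non-commutative polynomials over an alphabet is the space of finitely supported
  functions from words (lists) to the rationals. Alphabets:
  \<^item> for \<open>\<B>\<close>, the letter \<open>b\<^sub>i\<close> is the natural number \<open>i\<close>;
  \<^item> for \<open>\<Y>\<close>, the letter \<open>y\<^sub>k\<close> is the natural number \<open>k \<ge> 1\<close>, so the words over \<open>\<Y>\<close> are
    the lists \<open>v\<close> with \<open>0 \<notin> set v\<close>; with this encoding the map \<open>y\<^sub>k \<mapsto> b\<^sub>k\<close> on words
    (\<open>\<theta>\<^sub>\<Y>\<close>) is the inclusion of these lists into all lists.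
\<close>

type_synonym 'a ncpoly = "'a list \<Rightarrow>\<^sub>0 rat"

datatype xletter = X0 | X1

abbreviation word :: "'a list \<Rightarrow> 'a ncpoly" where
  "word w \<equiv> Poly_Mapping.single w 1"

definition scale :: "rat \<Rightarrow> 'a ncpoly \<Rightarrow> 'a ncpoly" where
  "scale c P = Poly_Mapping.map (\<lambda>r. c * r) P"

definition lin_ext :: "('a list \<Rightarrow> 'b ncpoly) \<Rightarrow> 'a ncpoly \<Rightarrow> 'b ncpoly" where
  "lin_ext f P = (\<Sum>w\<in>Poly_Mapping.keys P. scale (Poly_Mapping.lookup P w) (f w))"

definition prepend :: "'a \<Rightarrow> 'a ncpoly \<Rightarrow> 'a ncpoly" where
  "prepend a = lin_ext (\<lambda>w. word (a # w))"


section \<open>Quasi-shuffle products\<close>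

text \<open>The argument \<open>d\<close> describes the product of two letters; \<open>None\<close> stands for \<open>0\<close>.\<close>

fun quasi_shuffle :: "('a \<Rightarrow> 'a \<Rightarrow> 'a option) \<Rightarrow> 'a list \<Rightarrow> 'a list \<Rightarrow> 'a ncpoly" where
  "quasi_shuffle d [] w = word w"
| "quasi_shuffle d w [] = word w"
| "quasi_shuffle d (a # u) (b # v) =
     prepend a (quasi_shuffle d u (b # v)) + prepend b (quasi_shuffle d (a # u) v)
     + (case d a b of None \<Rightarrow> 0 | Some c \<Rightarrow> prepend c (quasi_shuffle d u v))"

definition shuffle_letters :: "'a \<Rightarrow> 'a \<Rightarrow> 'a option" where
  "shuffle_letters a b = None"

definition stuffle_letters :: "nat \<Rightarrow> nat \<Rightarrow> nat option" where
  "stuffle_letters i j = Some (i + j)"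

definition balanced_letters :: "nat \<Rightarrow> nat \<Rightarrow> nat option" where
  "balanced_letters i j = (if i \<ge> 1 \<and> j \<ge> 1 then Some (i + j) else None)"


section \<open>Rational algebras\<close>

abbreviation QQ :: "rat ring" where
  "QQ \<equiv> ring_of_type_algebra"

definition qsh_algebra :: "('a \<Rightarrow> 'a \<Rightarrow> 'a option) \<Rightarrow> (rat, 'a ncpoly) module" where
  "qsh_algebra d =
     \<lparr>carrier = UNIV,
      monoid.mult = (\<lambda>P Q. lin_ext (\<lambda>u. lin_ext (\<lambda>v. quasi_shuffle d u v) Q) P),
      one = word [],
      zero = 0,
      add = (+),
      module.smult = scale\<rparr>"

text \<open>
  The library's quotient ring \<^const>\<open>FactRing\<close> together with the induced scalar multiplication,
  defined on cosets in the same style as \<^const>\<open>rcoset_mult\<close>.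
\<close>

definition quot_algebra :: "('k, 'a) module \<Rightarrow> 'a set \<Rightarrow> ('k, 'a set) module" where
  "quot_algebra A I =
     \<lparr>carrier = carrier (A Quot I), monoid.mult = monoid.mult (A Quot I), one = one (A Quot I),
      zero = zero (A Quot I), add = add (A Quot I),
      module.smult = (\<lambda>c S. \<Union>a\<in>S. I +>\<^bsub>A\<^esub> (c \<odot>\<^bsub>A\<^esub> a))\<rparr>"

definition algebra_morphism ::
  "'k ring \<Rightarrow> ('k, 'a) module \<Rightarrow> ('k, 'b) module \<Rightarrow> ('a \<Rightarrow> 'b) \<Rightarrow> bool" where
  "algebra_morphism K A B h \<longleftrightarrow>
     algebra K A \<and> algebra K B \<and> h \<in> ring_hom A B \<and>
     (\<forall>c\<in>carrier K. \<forall>a\<in>carrier A. h (c \<odot>\<^bsub>A\<^esub> a) = c \<odot>\<^bsub>B\<^esub> h a)"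


section \<open>The algebra \<open>\<G>\<^sup>f\<close>\<close>

abbreviation balanced_algebra :: "(rat, nat ncpoly) module" where
  "balanced_algebra \<equiv> qsh_algebra balanced_letters"

text \<open>
  A word not starting with \<open>b\<^sub>0\<close> is uniquely of the form
  \<open>b\<^bsub>k\<^sub>1\<^esub> b\<^sub>0\<^bsup>m\<^sub>1\<^esup> \<dots> b\<^bsub>k\<^sub>d\<^esub> b\<^sub>0\<^bsup>m\<^sub>d\<^esup>\<close> with all \<open>k\<^sub>i \<ge> 1\<close>; it is given by the list
  of the pairs \<open>(k\<^sub>i, m\<^sub>i)\<close>, on which \<open>tau_blocks\<close> is the involution \<open>\<tau>\<close>.
\<close>

definition block_word :: "(nat \<times> nat) list \<Rightarrow> nat list" where
  "block_word kms = concat (map (\<lambda>(k, m). k # replicate m 0) kms)"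

definition tau_blocks :: "(nat \<times> nat) list \<Rightarrow> (nat \<times> nat) list" where
  "tau_blocks kms = rev (map (\<lambda>(k, m). (m + 1, k - 1)) kms)"

definition tau_relations :: "nat ncpoly set" where
  "tau_relations =
     {word (block_word kms) - word (block_word (tau_blocks kms)) | kms.
        \<forall>(k, m)\<in>set kms. k \<ge> 1}"

definition Gf_ideal :: "nat ncpoly set" where
  "Gf_ideal = Idl\<^bsub>balanced_algebra\<^esub> (insert (word [0]) tau_relations)"

definition Gf :: "(rat, nat ncpoly set) module" where
  "Gf = quot_algebra balanced_algebra Gf_ideal"

definition f_class :: "nat list \<Rightarrow> nat ncpoly set" where
  "f_class w = Gf_ideal +>\<^bsub>balanced_algebra\<^esub> word w"


section \<open>The algebra \<open>\<Z>\<^sup>f\<close> of formal multiple zeta values\<close>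

abbreviation shuffle_algebra :: "(rat, xletter ncpoly) module" where
  "shuffle_algebra \<equiv> qsh_algebra shuffle_letters"

text \<open>
  \<open>x_word\<close> maps \<open>y\<^bsub>k\<^sub>1\<^esub> \<dots> y\<^bsub>k\<^sub>d\<^esub>\<close> to \<open>x\<^sub>0\<^bsup>k\<^sub>1-1\<^esup> x\<^sub>1 \<dots> x\<^sub>0\<^bsup>k\<^sub>d-1\<^esup> x\<^sub>1\<close>. It is a bijection onto the
  words not ending in \<open>x\<^sub>0\<close>, and \<open>\<Pi>\<^sub>\<Y>\<close> is its inverse there and \<open>0\<close> on words ending in \<open>x\<^sub>0\<close>.
\<close>

definition x_word :: "nat list \<Rightarrow> xletter list" where
  "x_word ks = concat (map (\<lambda>k. replicate (k - 1) X0 @ [X1]) ks)"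

text \<open>
  The extended double shuffle relations (Ihara--Kaneko--Zagier): the shuffle regularisation of
  \<open>w\<^sub>0 * w\<^sub>1 - w\<^sub>0 \<squnion>\<squnion> w\<^sub>1\<close> vanishes for every admissible \<open>w\<^sub>0\<close> (empty, or with \<open>k\<^sub>1 \<ge> 2\<close>)
  and every \<open>w\<^sub>1\<close>. The regularisation is expressed by the two generators \<open>x\<^sub>0\<close> and \<open>x\<^sub>1\<close>:
  modulo the shuffle ideal they generate, every polynomial is congruent to its
  shuffle regularisation (with \<open>x\<^sub>0, x\<^sub>1 \<mapsto> 0\<close>).
\<close>

definition eds_relations :: "xletter ncpoly set" where
  "eds_relations =
     {word [X0], word [X1]} \<union>
     {lin_ext (\<lambda>v. word (x_word v)) (quasi_shuffle stuffle_letters w0 w1)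
        - quasi_shuffle shuffle_letters (x_word w0) (x_word w1) | w0 w1.
        0 \<notin> set w0 \<and> 0 \<notin> set w1 \<and> (w0 = [] \<or> hd w0 \<ge> 2)}"

definition Zf_ideal :: "xletter ncpoly set" where
  "Zf_ideal = Idl\<^bsub>shuffle_algebra\<^esub> eds_relations"

definition Zf :: "(rat, xletter ncpoly set) module" where
  "Zf = quot_algebra shuffle_algebra Zf_ideal"

definition zeta_sh :: "xletter list \<Rightarrow> xletter ncpoly set" where
  "zeta_sh w = Zf_ideal +>\<^bsub>shuffle_algebra\<^esub> word w"

definition zeta_single :: "nat \<Rightarrow> xletter ncpoly set" where
  "zeta_single n = zeta_sh (replicate (n - 1) X0 @ [X1])"


section \<open>Non-commutative power series and stuffle regularisation\<close>

text \<open>A power series with coefficients in an algebra is the function giving its coefficients.\<close>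

definition nc_mult ::
  "('k, 'r) module \<Rightarrow> ('a list \<Rightarrow> 'r) \<Rightarrow> ('a list \<Rightarrow> 'r) \<Rightarrow> 'a list \<Rightarrow> 'r" where
  "nc_mult A S T w = finsum A (\<lambda>(u, v). S u \<otimes>\<^bsub>A\<^esub> T v) {(u, v). w = u @ v}"

definition nc_one :: "('k, 'r) module \<Rightarrow> 'a list \<Rightarrow> 'r" where
  "nc_one A w = (if w = [] then \<one>\<^bsub>A\<^esub> else \<zero>\<^bsub>A\<^esub>)"

primrec nc_power :: "('k, 'r) module \<Rightarrow> ('a list \<Rightarrow> 'r) \<Rightarrow> nat \<Rightarrow> 'a list \<Rightarrow> 'r" where
  "nc_power A S 0 = nc_one A"
| "nc_power A S (Suc n) = nc_mult A S (nc_power A S n)"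

text \<open>
  Exponential of a series with constant term \<open>0\<close>: the \<open>n\<close>-th power of such a series has no
  terms of length less than \<open>n\<close>, so the sum over all \<open>n\<close> stops at the length of the word.
\<close>

definition nc_exp :: "(rat, 'r) module \<Rightarrow> ('a list \<Rightarrow> 'r) \<Rightarrow> 'a list \<Rightarrow> 'r" where
  "nc_exp A S w = finsum A (\<lambda>n. (1 / fact n) \<odot>\<^bsub>A\<^esub> nc_power A S n w) {0..length w}"

text \<open>The series \<open>\<Sum>\<^bsub>n\<ge>2\<^esub> (-1)\<^bsup>n-1\<^esup>/n \<zeta>\<^sup>f(n) y\<^sub>1\<^bsup>n\<^esup>\<close>.\<close>

definition corr_exponent :: "nat list \<Rightarrow> xletter ncpoly set" where
  "corr_exponent v =
     (let n = length v in
      if n \<ge> 2 \<and> v = replicate n 1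
      then ((- 1) ^ (n - 1) / of_nat n) \<odot>\<^bsub>Zf\<^esub> zeta_single n
      else \<zero>\<^bsub>Zf\<^esub>)"

text \<open>
  The coefficient of \<open>\<Sum>\<^sub>w \<zeta>\<^sup>f(w) \<Pi>\<^sub>\<Y>(w)\<close> at a word \<open>v\<close> over \<open>\<Y>\<close> is the value at \<open>x_word v\<close>,
  the only word which \<open>\<Pi>\<^sub>\<Y>\<close> maps to \<open>v\<close>. The stuffle regularised values are meaningful only
  for \<open>0 \<notin> set v\<close>.
\<close>

definition zeta_st :: "nat list \<Rightarrow> xletter ncpoly set" where
  "zeta_st = nc_mult Zf (nc_exp Zf corr_exponent) (\<lambda>v. zeta_sh (x_word v))"


section \<open>Comparison of the alphabets\<close>

definition theta_X_anti :: "xletter list \<Rightarrow> nat list" where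
  "theta_X_anti w = rev (map (\<lambda>x. case x of X0 \<Rightarrow> 0 | X1 \<Rightarrow> 1) w)"

end

theory Submission
  imports Defs "HOL-Computational_Algebra.Formal_Power_Series"
begin

text \<open>
  Deconcatenation is a morphism for the balanced quasi-shuffle product, so the map in question is
  multiplicative as the convolution of two multiplicative maps: \<open>\<zeta>\<^sub>\<squnion>\<close> on words in \<open>b\<^sub>0, b\<^sub>1\<close>, and
  \<open>\<zeta>\<^sub>*\<close> on words without \<open>b\<^sub>0\<close> (both extended by \<open>0\<close>).

  That \<open>\<zeta>\<^sub>*\<close> respects the stuffle product is the heart of the matter. Write \<open>e\<^sub>n\<close> for the coefficient of
  \<open>y\<^sub>1\<^bsup>n\<^esup>\<close> in the correction series. Every polynomial is a combination of products
  \<open>h * y\<^sub>1\<^bsup>n\<^esup>\<close> with \<open>h\<close> a word not starting with \<open>y\<^sub>1\<close>. The extended double shuffle relations give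
  \<open>\<zeta>\<^sub>*(h * a) = \<zeta>(h) \<zeta>\<^sub>*(a)\<close>, and \<open>\<zeta>\<^sub>*(y\<^sub>1\<^bsup>n\<^esup>) = e\<^sub>n\<close>. Newton's identity
  \<open>n y\<^sub>1\<^bsup>n\<^esup> = \<Sum>\<^sub>k (-1)\<^bsup>k-1\<^esup> y\<^sub>k * y\<^sub>1\<^bsup>n-k\<^esup>\<close> matches the recursion
  \<open>n e\<^sub>n = \<Sum>\<^bsub>k\<ge>2\<^esub> (-1)\<^bsup>k-1\<^esup> \<zeta>(k) e\<^bsub>n-k\<^esub>\<close> coming from the exponential, which forces first
  \<open>\<zeta>\<^sub>*(y\<^sub>1 * a) = 0\<close> and then \<open>\<zeta>\<^sub>*(y\<^sub>1\<^bsup>n\<^esup> * a) = e\<^sub>n \<zeta>\<^sub>*(a)\<close>.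

  Expanding \<open>\<zeta>\<^sub>*\<close>, the value at a word given by a sequence \<open>w\<close> of blocks is the sum of
  \<open>\<zeta>(\<tau> A) e\<^sub>B \<zeta>(C)\<close> over all \<open>w = A B C\<close> with \<open>B\<close> a power of \<open>b\<^sub>1\<close>. Since \<open>\<tau>\<close> reverses the order of
  the blocks, this is visibly invariant under \<open>\<tau>\<close>. Surjectivity holds because the value at
  \<open>u b\<^sub>1\<^bsup>n\<^esup>\<close> is \<open>\<zeta>\<^sub>\<squnion>(u b\<^sub>1\<^bsup>n\<^esup>)\<close> up to terms with fewer trailing \<open>b\<^sub>1\<close>.
\<close>


section \<open>Linear maps on non-commutative polynomials\<close>

lemma lookup_scale [simp]: "Poly_Mapping.lookup (scale c P) w = c * Poly_Mapping.lookup P w"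
  unfolding scale_def by (simp add: Poly_Mapping.map.rep_eq when_def)

lemma scale_add_right [simp]: "scale c (P + Q) = scale c P + scale c Q"
  and scale_add_left: "scale (c + c') P = scale c P + scale c' P"
  and scale_scale [simp]: "scale c (scale c' P) = scale (c * c') P"
  and scale_one [simp]: "scale 1 P = P"
  and scale_zero_left [simp]: "scale 0 P = 0"
  and scale_zero_right [simp]: "scale c 0 = 0"
  and scale_minus_one: "scale (-1) P = - P"
  and scale_single [simp]: "scale c (Poly_Mapping.single w c') = Poly_Mapping.single w (c * c')"
  by (rule poly_mapping_eqI; simp add: lookup_add algebra_simps lookup_single when_def)+

lemma scale_sum: "scale c (\<Sum>i\<in>A. P i) = (\<Sum>i\<in>A. scale c (P i))"
  by (induction A rule: infinite_finite_induct) auto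

lemma keys_scale: "Poly_Mapping.keys (scale c P) \<subseteq> Poly_Mapping.keys P"
  by (auto simp: in_keys_iff)

lemma ncpoly_as_sum: "P = (\<Sum>w\<in>Poly_Mapping.keys P. scale (Poly_Mapping.lookup P w) (word w))"
  by (rule poly_mapping_eqI)
    (simp add: lookup_sum lookup_single when_def sum.delta' in_keys_iff if_distrib cong: if_cong)

text \<open>Reduces the comparison of linear maps to words; the zero polynomial arises as
  \<open>scale 0\<close> of a word.\<close>

lemma ncpoly_induct [case_names word add scale]:
  assumes "\<And>w. \<Phi> (word w)" and "\<And>P Q. \<Phi> P \<Longrightarrow> \<Phi> Q \<Longrightarrow> \<Phi> (P + Q)"
    and "\<And>c P. \<Phi> P \<Longrightarrow> \<Phi> (scale c P)"
  shows "\<Phi> P"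
proof -
  have "\<Phi> 0" using assms(3)[OF assms(1), of 0] by simp
  then have "\<Phi> (\<Sum>w\<in>A. scale (Poly_Mapping.lookup P w) (word w))" for A
    by (induction A rule: infinite_finite_induct) (auto simp del: scale_single intro: assms)
  from this[of "Poly_Mapping.keys P"] show ?thesis using ncpoly_as_sum[of P] by simp
qed

lemma lin_ext_superset:
  assumes "finite A" "Poly_Mapping.keys P \<subseteq> A"
  shows "lin_ext f P = (\<Sum>w\<in>A. scale (Poly_Mapping.lookup P w) (f w))"
  unfolding lin_ext_def by (rule sum.mono_neutral_left) (use assms in \<open>auto simp: in_keys_iff\<close>)

lemma lin_ext_add [simp]: "lin_ext f (P + Q) = lin_ext f P + lin_ext f Q"
proof -
  let ?A = "Poly_Mapping.keys P \<union> Poly_Mapping.keys Q"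
  show ?thesis using keys_add[of P Q]
    by (simp add: lin_ext_superset[of ?A] lookup_add scale_add_left sum.distrib)
qed

lemma lin_ext_scale [simp]: "lin_ext f (scale c P) = scale c (lin_ext f P)"
  by (subst lin_ext_superset[of "Poly_Mapping.keys P" "scale c P"])
    (auto simp: lin_ext_def scale_sum keys_scale intro: subsetD[OF keys_scale])

lemma lin_ext_word [simp]: "lin_ext f (word w) = f w"
  by (simp add: lin_ext_def)

lemma lin_ext_zero [simp]: "lin_ext f 0 = 0"
  by (simp add: lin_ext_def)

lemma lin_ext_fun_add: "lin_ext (\<lambda>w. f w + g w) P = lin_ext f P + lin_ext g P"
  by (simp add: lin_ext_def sum.distrib)

lemma lin_ext_fun_scale: "lin_ext (\<lambda>w. scale c (f w)) P = scale c (lin_ext f P)"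
  by (simp add: lin_ext_def scale_sum mult.commute)

lemma lin_ext_compose: "lin_ext f (lin_ext g P) = lin_ext (\<lambda>w. lin_ext f (g w)) P"
  by (induction P rule: ncpoly_induct) simp_all

lemma prepend_simps [simp]:
  "prepend a (P + Q) = prepend a P + prepend a Q"
  "prepend a (scale c P) = scale c (prepend a P)"
  "prepend a (word w) = word (a # w)"
  "prepend a 0 = 0"
  by (simp_all add: prepend_def)

lemma prepend_single [simp]: "prepend a (Poly_Mapping.single w c) = Poly_Mapping.single (a # w) c"
  using prepend_simps(2)[of a c "word w"] by (simp add: prepend_simps(3))

lemma prepend_sum: "prepend a (\<Sum>i\<in>A. P i) = (\<Sum>i\<in>A. prepend a (P i))"
  by (induction A rule: infinite_finite_induct) auto

lemma keys_lin_ext: "Poly_Mapping.keys (lin_ext f P) \<subseteq> (\<Union>w\<in>Poly_Mapping.keys P. Poly_Mapping.keys (f w))"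
  unfolding lin_ext_def by (rule order.trans[OF keys_sum]) (use keys_scale in blast)

lemma keys_prepend: "Poly_Mapping.keys (prepend a P) \<subseteq> (#) a ` Poly_Mapping.keys P"
  unfolding prepend_def using keys_lin_ext by fastforce


section \<open>Quasi-shuffle algebras\<close>

definition qmul :: "('a \<Rightarrow> 'a \<Rightarrow> 'a option) \<Rightarrow> 'a ncpoly \<Rightarrow> 'a ncpoly \<Rightarrow> 'a ncpoly" where
  "qmul d P Q = lin_ext (\<lambda>u. lin_ext (\<lambda>v. quasi_shuffle d u v) Q) P"

lemma qmul_simps [simp]:
  "qmul d (P + P') Q = qmul d P Q + qmul d P' Q"
  "qmul d P (Q + Q') = qmul d P Q + qmul d P Q'"
  "qmul d (scale c P) Q = scale c (qmul d P Q)"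
  "qmul d P (scale c Q) = scale c (qmul d P Q)"
  "qmul d 0 Q = 0" "qmul d P 0 = 0"
  "qmul d (word u) (word v) = quasi_shuffle d u v"
proof -
  show "qmul d P (scale c Q) = scale c (qmul d P Q)"
    by (simp add: qmul_def lin_ext_fun_scale)
qed (simp_all add: qmul_def lin_ext_fun_add lin_ext_def[of _ P])

lemma qmul_minus_left [simp]: "qmul d (- P) Q = - qmul d P Q"
  using qmul_simps(3)[of d "-1" P Q] by (simp only: scale_minus_one)

lemma qmul_sum_left: "qmul d (\<Sum>i\<in>A. P i) Q = (\<Sum>i\<in>A. qmul d (P i) Q)"
  by (induction A rule: infinite_finite_induct) auto

lemma quasi_shuffle_Nil_right [simp]: "quasi_shuffle d u [] = word u"
  by (cases u) auto

lemma qmul_one_left [simp]: "qmul d (word []) P = P"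
  by (induction P rule: ncpoly_induct) auto

lemma qmul_one_right [simp]: "qmul d P (word []) = P"
  by (induction P rule: ncpoly_induct) auto

text \<open>With a zero letter product encoded as \<open>None\<close>, the merging term of the
  recursion stays linear in the polynomial, and all letter products are handled alike.\<close>

definition prepend_opt :: "'a option \<Rightarrow> 'a ncpoly \<Rightarrow> 'a ncpoly" where
  "prepend_opt a P = (case a of None \<Rightarrow> 0 | Some c \<Rightarrow> prepend c P)"

lemma prepend_opt_simps [simp]:
  "prepend_opt o' (P + Q) = prepend_opt o' P + prepend_opt o' Q"
  "prepend_opt o' (scale c P) = scale c (prepend_opt o' P)"
  "prepend_opt None P = 0"
  "prepend_opt (Some a) P = prepend a P"
  by (simp_all add: prepend_opt_def split: option.split)

declare quasi_shuffle.simps(3) [simp del]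

lemma quasi_shuffle_Cons:
  "quasi_shuffle d (a # u) (b # v) =
     prepend a (quasi_shuffle d u (b # v)) + prepend b (quasi_shuffle d (a # u) v)
     + prepend_opt (d a b) (quasi_shuffle d u v)"
  by (simp add: prepend_opt_def quasi_shuffle.simps)

lemma qmul_prepend_word:
  "qmul d (prepend a P) (word (b # v)) =
     prepend a (qmul d P (word (b # v))) + prepend b (qmul d (prepend a P) (word v))
     + prepend_opt (d a b) (qmul d P (word v))"
  by (induction P rule: ncpoly_induct)
    (simp_all add: quasi_shuffle_Cons algebra_simps)

lemma qmul_prepend:
  "qmul d (prepend a P) (prepend b Q) =
     prepend a (qmul d P (prepend b Q)) + prepend b (qmul d (prepend a P) Q)
     + prepend_opt (d a b) (qmul d P Q)"
  by (induction Q rule: ncpoly_induct) (simp_all add: qmul_prepend_word algebra_simps)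

lemma qmul_prepend_opt_left:
  "qmul d (prepend_opt a P) (prepend b Q) =
     prepend_opt a (qmul d P (prepend b Q)) + prepend b (qmul d (prepend_opt a P) Q)
     + prepend_opt (Option.bind a (\<lambda>x. d x b)) (qmul d P Q)"
  by (cases a) (simp_all add: qmul_prepend)

lemma qmul_prepend_opt_right:
  "qmul d (prepend a P) (prepend_opt b Q) =
     prepend a (qmul d P (prepend_opt b Q)) + prepend_opt b (qmul d (prepend a P) Q)
     + prepend_opt (Option.bind b (\<lambda>x. d a x)) (qmul d P Q)"
  by (cases b) (simp_all add: qmul_prepend)

lemma two_list_induct [case_names Nil1 Nil2 Cons]:
  assumes "\<And>v. \<Phi> [] v" "\<And>a u. \<Phi> (a # u) []"
    and "\<And>a u b v. \<Phi> u (b # v) \<Longrightarrow> \<Phi> (a # u) v \<Longrightarrow> \<Phi> u v \<Longrightarrow> \<Phi> (a # u) (b # v)"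
  shows "\<Phi> u v"
proof (induction u arbitrary: v)
  case (Cons a u)
  show ?case by (induction v) (auto intro: assms Cons)
qed (rule assms)

text \<open>The letter product, with \<open>None\<close> as absorbing zero, is commutative and
  associative; the quasi-shuffle product inherits both properties.\<close>

locale quasi_shuffle_algebra =
  fixes d :: "'a \<Rightarrow> 'a \<Rightarrow> 'a option"
  assumes letter_commute: "d a b = d b a"
    and letter_assoc: "Option.bind (d a b) (\<lambda>x. d x c) = Option.bind (d b c) (\<lambda>x. d a x)"
begin

lemma quasi_shuffle_commute: "quasi_shuffle d u v = quasi_shuffle d v u"
  by (induction u v rule: two_list_induct)
    (simp_all add: letter_commute[of a b for a b] quasi_shuffle_Cons algebra_simps)

lemma qmul_commute: "qmul d P Q = qmul d Q P"
proof (induction P rule: ncpoly_induct)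
  case (word u)
  show ?case by (induction Q rule: ncpoly_induct) (simp_all add: quasi_shuffle_commute)
qed simp_all

text \<open>Induction on the total length. Each side expands into seven terms, one for each nonempty
  set of first letters that make up the leading letter of the result. They agree by the induction
  hypothesis, together with \<open>letter_assoc\<close> when all three letters merge.\<close>

lemma quasi_shuffle_assoc:
  "qmul d (quasi_shuffle d u v) (word w) = qmul d (word u) (quasi_shuffle d v w)"
proof (induction "length u + length v + length w" arbitrary: u v w rule: less_induct)
  case less
  show ?case
  proof (cases "u = [] \<or> v = [] \<or> w = []")
    case True
    then show ?thesis by auto
  next
    case False
    then obtain a u' b v' c w' where eq: "u = a # u'" "v = b # v'" "w = c # w'"
      by (metis neq_Nil_conv)
    note IH = less[unfolded eq]
    have word_Cons: "word (x # xs) = prepend x (word xs)" for x :: 'a and xs by simp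
    let ?U = "word u'" and ?V = "word v'" and ?W = "word w'"
    let ?m = "qmul d" and ?A = "prepend a" and ?B = "prepend b" and ?C = "prepend c"
    have IHs:
      "?m (?m ?U (?B ?V)) (?C ?W) = ?m ?U (?m (?B ?V) (?C ?W))"
      "?m (?m (?A ?U) ?V) (?C ?W) = ?m (?A ?U) (?m ?V (?C ?W))"
      "?m (?m (?A ?U) (?B ?V)) ?W = ?m (?A ?U) (?m (?B ?V) ?W)"
      "?m (?m ?U ?V) (?C ?W) = ?m ?U (?m ?V (?C ?W))"
      "?m (?m ?U (?B ?V)) ?W = ?m ?U (?m (?B ?V) ?W)"
      "?m (?m (?A ?U) ?V) ?W = ?m (?A ?U) (?m ?V ?W)"
      "?m (?m ?U ?V) ?W = ?m ?U (?m ?V ?W)"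
      using IH[of u' "b # v'" "c # w'"] IH[of "a # u'" v' "c # w'"] IH[of "a # u'" "b # v'" w']
        IH[of u' v' "c # w'"] IH[of u' "b # v'" w'] IH[of "a # u'" v' w'] IH[of u' v' w']
      by (simp_all)
    have L: "?m (?m (?A ?U) (?B ?V)) (?C ?W) =
        ?A (?m (?m ?U (?B ?V)) (?C ?W)) + prepend_opt (d a c) (?m (?m ?U (?B ?V)) ?W)
      + ?B (?m (?m (?A ?U) ?V) (?C ?W)) + prepend_opt (d b c) (?m (?m (?A ?U) ?V) ?W)
      + prepend_opt (d a b) (?m (?m ?U ?V) (?C ?W))
      + prepend_opt (Option.bind (d a b) (\<lambda>x. d x c)) (?m (?m ?U ?V) ?W)
      + ?C (?m (?m (?A ?U) (?B ?V)) ?W)"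
      by (simp only: qmul_prepend[of d a _ b] qmul_simps(1,2) qmul_prepend[of d _ _ c]
          qmul_prepend_opt_left prepend_simps(1) prepend_opt_simps(1) ac_simps)
    have R: "?m (?A ?U) (?m (?B ?V) (?C ?W)) =
        ?B (?m (?A ?U) (?m ?V (?C ?W))) + prepend_opt (d a b) (?m ?U (?m ?V (?C ?W)))
      + ?C (?m (?A ?U) (?m (?B ?V) ?W)) + prepend_opt (d a c) (?m ?U (?m (?B ?V) ?W))
      + prepend_opt (d b c) (?m (?A ?U) (?m ?V ?W))
      + prepend_opt (Option.bind (d b c) (\<lambda>x. d a x)) (?m ?U (?m ?V ?W))
      + ?A (?m ?U (?m (?B ?V) (?C ?W)))"
      by (simp only: qmul_prepend[of d b _ c] qmul_simps(1,2) qmul_prepend[of d a]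
          qmul_prepend_opt_right prepend_simps(1) prepend_opt_simps(1) ac_simps)
    have "?m (?m (?A ?U) (?B ?V)) (?C ?W) = ?m (?A ?U) (?m (?B ?V) (?C ?W))"
      unfolding L R IHs letter_assoc by (simp only: ac_simps)
    then show ?thesis unfolding eq by (simp)
  qed
qed

lemma qmul_assoc: "qmul d (qmul d P Q) R = qmul d P (qmul d Q R)"
proof (induction P rule: ncpoly_induct)
  case (word u)
  show ?case
  proof (induction Q rule: ncpoly_induct)
    case (word v)
    show ?case by (induction R rule: ncpoly_induct) (simp_all add: quasi_shuffle_assoc)
  qed simp_all
qed simp_all

lemma qmul_left_commute: "qmul d P (qmul d Q R) = qmul d Q (qmul d P R)"
  by (metis qmul_assoc qmul_commute)

lemmas qmul_ac = qmul_assoc qmul_commute qmul_left_commute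

lemma cring_qsh_algebra: "cring (qsh_algebra d)"
proof (rule cringI)
  show "abelian_group (qsh_algebra d)"
  proof (rule abelian_groupI)
    fix x assume "x \<in> carrier (qsh_algebra d)"
    show "\<exists>y\<in>carrier (qsh_algebra d). y \<oplus>\<^bsub>qsh_algebra d\<^esub> x = \<zero>\<^bsub>qsh_algebra d\<^esub>"
      by (rule bexI[of _ "-x"]) (simp_all add: qsh_algebra_def)
  qed (simp_all add: qsh_algebra_def ac_simps)
  show "comm_monoid (qsh_algebra d)"
    by (rule comm_monoidI)
      (simp_all add: qsh_algebra_def qmul_def[symmetric] qmul_ac)
qed (simp add: qsh_algebra_def qmul_def[symmetric])

lemma algebra_qsh_algebra: "algebra QQ (qsh_algebra d)"
  by (rule algebraI[OF cring_from_type_algebra cring_qsh_algebra])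
    (simp_all add: qsh_algebra_def qmul_def[symmetric] scale_add_left ring_of_type_algebra_def)

end

lemma qsh_algebra_simps [simp]:
  "carrier (qsh_algebra d) = UNIV"
  "\<one>\<^bsub>qsh_algebra d\<^esub> = word []"
  "\<zero>\<^bsub>qsh_algebra d\<^esub> = 0"
  "P \<oplus>\<^bsub>qsh_algebra d\<^esub> Q = P + Q"
  "P \<otimes>\<^bsub>qsh_algebra d\<^esub> Q = qmul d P Q"
  "c \<odot>\<^bsub>qsh_algebra d\<^esub> P = scale c P"
  by (simp_all add: qsh_algebra_def qmul_def)

global_interpretation balanced: quasi_shuffle_algebra balanced_letters
  by unfold_locales (auto simp: balanced_letters_def)

global_interpretation shuffle: quasi_shuffle_algebra shuffle_letters
  by unfold_locales (auto simp: shuffle_letters_def)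

section \<open>Letters occurring in the terms of a quasi-shuffle product\<close>

lemma keys_quasi_shuffle_Cons:
  assumes "w \<in> Poly_Mapping.keys (quasi_shuffle d (a # u) (b # v))"
  obtains w' where "w = a # w'" "w' \<in> Poly_Mapping.keys (quasi_shuffle d u (b # v))"
  | w' where "w = b # w'" "w' \<in> Poly_Mapping.keys (quasi_shuffle d (a # u) v)"
  | c w' where "d a b = Some c" "w = c # w'" "w' \<in> Poly_Mapping.keys (quasi_shuffle d u v)"
proof -
  let ?P = "prepend a (quasi_shuffle d u (b # v))" and ?Q = "prepend b (quasi_shuffle d (a # u) v)"
    and ?R = "prepend_opt (d a b) (quasi_shuffle d u v)"
  have "w \<in> Poly_Mapping.keys ?P \<or> w \<in> Poly_Mapping.keys ?Q \<or> w \<in> Poly_Mapping.keys ?R"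
    using assms subsetD[OF keys_add[of "?P + ?Q" ?R], of w] subsetD[OF keys_add[of ?P ?Q], of w]
    by (simp only: quasi_shuffle_Cons Un_iff) argo
  then consider "w \<in> Poly_Mapping.keys ?P" | "w \<in> Poly_Mapping.keys ?Q"
    | "w \<in> Poly_Mapping.keys ?R" by blast
  then show ?thesis
  proof cases
    case 1
    then have "w \<in> (#) a ` Poly_Mapping.keys (quasi_shuffle d u (b # v))"
      using keys_prepend by (rule subsetD[rotated])
    then show ?thesis by (elim imageE) (rule that(1))
  next
    case 2
    then have "w \<in> (#) b ` Poly_Mapping.keys (quasi_shuffle d (a # u) v)"
      using keys_prepend by (rule subsetD[rotated])
    then show ?thesis by (elim imageE) (rule that(2))
  next
    case 3
    then obtain c where c: "d a b = Some c" by (cases "d a b") auto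
    with 3 have "w \<in> (#) c ` Poly_Mapping.keys (quasi_shuffle d u v)"
      using keys_prepend by (metis prepend_opt_simps(4) subsetD)
    with c show ?thesis by (elim imageE) (rule that(3))
  qed
qed

text \<open>If \<open>S\<close> absorbs its partners when letters merge, a letter of
  \<open>S\<close> cannot disappear from any term. Functionals that are zero on words meeting
  \<open>S\<close> therefore vanish on such products.\<close>

lemma quasi_shuffle_meets:
  assumes "\<And>a b c. d a b = Some c \<Longrightarrow> a \<in> S \<or> b \<in> S \<Longrightarrow> c \<in> S"
    and "set u \<inter> S \<noteq> {} \<or> set v \<inter> S \<noteq> {}" and "w \<in> Poly_Mapping.keys (quasi_shuffle d u v)"
  shows "set w \<inter> S \<noteq> {}"
  using assms(2,3)
proof (induction u v arbitrary: w rule: two_list_induct)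
  case (Cons a u b v)
  from Cons.prems(2) show ?case
  proof (cases rule: keys_quasi_shuffle_Cons)
    case (1 w')
    show ?thesis
      using Cons.IH(1)[OF _ 1(2)] Cons.prems(1) unfolding 1(1) by (cases "a \<in> S") auto
  next
    case (2 w')
    show ?thesis
      using Cons.IH(2)[OF _ 2(2)] Cons.prems(1) unfolding 2(1) by (cases "b \<in> S") auto
  next
    case (3 c w')
    show ?thesis
      using Cons.IH(3)[OF _ 3(3)] Cons.prems(1) assms(1)[OF 3(1)] unfolding 3(2)
      by (cases "a \<in> S \<or> b \<in> S") auto
  qed
qed auto

lemma quasi_shuffle_avoids:
  assumes "\<And>a b c. d a b = Some c \<Longrightarrow> a \<notin> S \<Longrightarrow> b \<notin> S \<Longrightarrow> c \<notin> S"
    and "set u \<inter> S = {}" "set v \<inter> S = {}" and "w \<in> Poly_Mapping.keys (quasi_shuffle d u v)"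
  shows "set w \<inter> S = {}"
  using assms(2-)
proof (induction u v arbitrary: w rule: two_list_induct)
  case (Cons a u b v)
  from Cons.prems(3) show ?case
  proof (cases rule: keys_quasi_shuffle_Cons)
    case (1 w')
    show ?thesis
      using Cons.IH(1)[OF _ _ 1(2)] Cons.prems(1,2) unfolding 1(1) by auto
  next
    case (2 w')
    show ?thesis
      using Cons.IH(2)[OF _ _ 2(2)] Cons.prems(1,2) unfolding 2(1) by auto
  next
    case (3 c w')
    show ?thesis
      using Cons.IH(3)[OF _ _ 3(3)] Cons.prems(1,2) assms(1)[OF 3(1)] unfolding 3(2) by auto
  qed
qed auto


section \<open>Deconcatenation and convolution\<close>

definition splits :: "'a list \<Rightarrow> ('a list \<times> 'a list) set" where
  "splits w = {(u, v). w = u @ v}"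

lemma splits_Nil [simp]: "splits [] = {([], [])}"
  by (auto simp: splits_def)

lemma splits_Cons: "splits (a # w) = insert ([], a # w) ((\<lambda>(u, v). (a # u, v)) ` splits w)"
  by (auto simp: splits_def Cons_eq_append_conv image_iff)

lemma finite_splits [simp]: "finite (splits w)"
  by (induction w) (simp_all add: splits_Cons)

definition split_sum :: "('a list \<Rightarrow> 'a list \<Rightarrow> 'r) \<Rightarrow> 'a list \<Rightarrow> 'r::comm_monoid_add" where
  "split_sum F w = (\<Sum>(u, v)\<in>splits w. F u v)"

lemma split_sum_Nil [simp]: "split_sum F [] = F [] []"
  by (simp add: split_sum_def)

lemma split_sum_Cons [simp]:
  "split_sum F (a # w) = F [] (a # w) + split_sum (\<lambda>u v. F (a # u) v) w"
proof -
  have "inj_on (\<lambda>(u, v). (a # u, v)) (splits w)"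
    by (auto simp: inj_on_def)
  then show ?thesis
    unfolding split_sum_def splits_Cons
    by (subst sum.insert) (auto simp: sum.reindex o_def case_prod_unfold)
qed

lemma split_sum_add: "split_sum (\<lambda>u v. F u v + G u v) w = split_sum F w + split_sum G w"
  by (simp add: split_sum_def case_prod_beta sum.distrib)

lemma split_sum_mult_left: "split_sum (\<lambda>u v. c * F u v) w = c * split_sum F w"
  for c :: "'r::comm_ring_1"
  by (simp add: split_sum_def case_prod_beta sum_distrib_left)

lemma split_sum_mult_right: "split_sum (\<lambda>u v. F u v * c) w = split_sum F w * c"
  for c :: "'r::comm_ring_1"
  by (simp add: split_sum_def case_prod_beta sum_distrib_right)

lemma split_sum_cong:
  assumes "\<And>u v. w = u @ v \<Longrightarrow> F u v = G u v"
  shows "split_sum F w = split_sum G w"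
  unfolding split_sum_def by (rule sum.cong) (use assms in \<open>auto simp: splits_def\<close>)

lemma split_sum_zero [simp]: "split_sum (\<lambda>u v. 0) w = 0"
  by (simp add: split_sum_def)

definition conv :: "('a list \<Rightarrow> 'r) \<Rightarrow> ('a list \<Rightarrow> 'r) \<Rightarrow> 'a list \<Rightarrow> 'r::comm_ring_1" where
  "conv \<phi> \<psi> = split_sum (\<lambda>u v. \<phi> u * \<psi> v)"

lemma conv_Nil [simp]: "conv \<phi> \<psi> [] = \<phi> [] * \<psi> []"
  and conv_Cons: "conv \<phi> \<psi> (a # w) = \<phi> [] * \<psi> (a # w) + conv (\<lambda>u. \<phi> (a # u)) \<psi> w"
  by (simp_all add: conv_def)

text \<open>\<open>q\<close> is the structure map of a commutative rational algebra; scalars act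
  through it.\<close>

locale rat_algebra =
  fixes q :: "rat \<Rightarrow> 'r::comm_ring_1"
  assumes q_add: "q (x + y) = q x + q y" and q_mult: "q (x * y) = q x * q y" and q_1: "q 1 = 1"
begin

lemma q_0 [simp]: "q 0 = 0"
  using q_add[of 0 0] by simp

lemma q_of_nat [simp]: "q (of_nat n) = of_nat n"
  by (induction n) (simp_all add: q_add q_1)

lemma q_minus: "q (- x) = - q x"
  using q_add[of "-x" x] by (simp add: eq_neg_iff_add_eq_0)

lemma q_power: "q (x ^ n) = q x ^ n"
  by (induction n) (simp_all add: q_mult q_1)

lemma of_nat_cancel:
  fixes x y :: 'r
  assumes "n > 0" "of_nat n * x = of_nat n * y"
  shows "x = y"
proof -
  have "q (1 / of_nat n) * of_nat n = q (1 / of_nat n * of_nat n)"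
    by (simp only: q_mult q_of_nat)
  then have inv: "q (1 / of_nat n) * of_nat n = 1"
    using assms(1) by (simp add: q_1)
  have "x = q (1 / of_nat n) * (of_nat n * x)" for x :: 'r
    by (simp only: inv mult.assoc[symmetric] mult_1_left)
  from this[of x] this[of y] show ?thesis by (simp only: assms(2))
qed

definition ext :: "('a list \<Rightarrow> 'r) \<Rightarrow> 'a ncpoly \<Rightarrow> 'r" where
  "ext f P = (\<Sum>w\<in>Poly_Mapping.keys P. q (Poly_Mapping.lookup P w) * f w)"

lemma ext_superset:
  assumes "finite A" "Poly_Mapping.keys P \<subseteq> A"
  shows "ext f P = (\<Sum>w\<in>A. q (Poly_Mapping.lookup P w) * f w)"
  unfolding ext_def by (rule sum.mono_neutral_left) (use assms in \<open>auto simp: in_keys_iff\<close>)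

lemma ext_add [simp]: "ext f (P + Q) = ext f P + ext f Q"
proof -
  let ?A = "Poly_Mapping.keys P \<union> Poly_Mapping.keys Q"
  show ?thesis using keys_add[of P Q]
    by (simp add: ext_superset[of ?A] lookup_add q_add sum.distrib algebra_simps)
qed

lemma ext_scale [simp]: "ext f (scale c P) = q c * ext f P"
  by (subst ext_superset[of "Poly_Mapping.keys P" "scale c P"])
    (auto simp: ext_def sum_distrib_left q_mult mult.assoc intro: subsetD[OF keys_scale])

lemma ext_word [simp]: "ext f (word w) = f w"
  by (simp add: ext_def q_1)

lemma ext_zero [simp]: "ext f 0 = 0"
  by (simp add: ext_def)

lemma ext_minus [simp]: "ext f (- P) = - ext f P"
  using ext_add[of f "-P" P] by (simp add: eq_neg_iff_add_eq_0)

lemma ext_diff: "ext f (P - Q) = ext f P - ext f Q"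
  using ext_add[of f P "-Q"] by simp

lemma ext_sum: "ext f (\<Sum>i\<in>A. P i) = (\<Sum>i\<in>A. ext f (P i))"
  by (induction A rule: infinite_finite_induct) auto

lemma ext_lin_ext: "ext f (lin_ext g P) = ext (\<lambda>w. ext f (g w)) P"
  by (induction P rule: ncpoly_induct) simp_all

lemma ext_prepend: "ext f (prepend a P) = ext (\<lambda>w. f (a # w)) P"
  by (induction P rule: ncpoly_induct) simp_all

lemma ext_eq_0: "(\<And>w. w \<in> Poly_Mapping.keys P \<Longrightarrow> f w = 0) \<Longrightarrow> ext f P = 0"
  by (simp add: ext_def)

lemma ext_cong: "(\<And>w. w \<in> Poly_Mapping.keys P \<Longrightarrow> f w = g w) \<Longrightarrow> ext f P = ext g P"
  by (simp add: ext_def)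

lemma ext_fun_add: "ext (\<lambda>w. f w + g w) P = ext f P + ext g P"
  by (simp add: ext_def sum.distrib algebra_simps)

lemma ext_fun_mult: "ext (\<lambda>w. c * f w) P = c * ext f P"
  by (simp add: ext_def sum_distrib_left mult.left_commute)

lemma ext_fun_zero [simp]: "ext (\<lambda>w. 0) P = 0"
  by (simp add: ext_def)

definition multiplicative :: "('a \<Rightarrow> 'a \<Rightarrow> 'a option) \<Rightarrow> ('a list \<Rightarrow> 'r) \<Rightarrow> bool" where
  "multiplicative d f \<longleftrightarrow> (\<forall>u v. ext f (quasi_shuffle d u v) = f u * f v)"

lemma multiplicative_ext:
  assumes "multiplicative d f"
  shows "ext f (qmul d P Q) = ext f P * ext f Q"
proof (induction P rule: ncpoly_induct)
  case (word u)
  show ?case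
    by (induction Q rule: ncpoly_induct)
      (use assms in \<open>simp_all add: multiplicative_def algebra_simps\<close>)
qed (simp_all add: algebra_simps)

text \<open>Deconcatenation is a morphism for the quasi-shuffle product; this is that fact paired with
  an arbitrary tensor \<open>\<phi> \<otimes> \<psi>\<close>.\<close>

lemma ext_conv_quasi_shuffle:
  "ext (conv \<phi> \<psi>) (quasi_shuffle d u v) =
     split_sum (\<lambda>u1 u2. split_sum (\<lambda>v1 v2.
       ext \<phi> (quasi_shuffle d u1 v1) * ext \<psi> (quasi_shuffle d u2 v2)) v) u"
proof (induction u v arbitrary: \<phi> rule: two_list_induct)
  case (Cons a u b v)
  let ?S = "quasi_shuffle d"
  \<comment> \<open>\<open>tail \<phi> x\<close> evaluates \<open>\<phi>\<close> with the optional
    letter \<open>x\<close> put in front, and is \<open>0\<close> for a zero letter product. The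
    recursion replaces \<open>\<phi>\<close> by its tails, hence the induction over all
    \<open>\<phi>\<close>.\<close>
  define tail where
    "tail \<phi> x = (\<lambda>w. case x of None \<Rightarrow> 0 | Some c \<Rightarrow> \<phi> (c # w))" for \<phi> :: "'a list \<Rightarrow> 'r" and x
  let ?T = "\<lambda>\<phi> u v. split_sum (\<lambda>u1 u2. split_sum (\<lambda>v1 v2.
       ext \<phi> (?S u1 v1) * ext \<psi> (?S u2 v2)) v) u"
  have tail: "ext f (prepend_opt x P) = ext (tail f x) P" for f x P
    by (cases x) (simp_all add: tail_def ext_prepend)
  have tail_Some: "tail f (Some x) = (\<lambda>w. f (x # w))" for f x
    by (simp add: tail_def)
  have conv_tail: "tail (conv \<phi> \<psi>) x = (\<lambda>w. \<phi> [] * tail \<psi> x w + conv (tail \<phi> x) \<psi> w)" for x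
    by (cases x) (simp_all add: tail_def conv_Cons conv_def)
  have opt: "ext (conv \<phi> \<psi>) (prepend_opt x P) =
      \<phi> [] * ext \<psi> (prepend_opt x P) + ext (conv (tail \<phi> x) \<psi>) P" for x P
    by (simp add: tail conv_tail ext_fun_add ext_fun_mult)
  note step = opt[of "Some x" for x, unfolded prepend_opt_simps]
  have "ext (conv \<phi> \<psi>) (?S (a # u) (b # v)) = \<phi> [] * ext \<psi> (?S (a # u) (b # v))
      + (?T (tail \<phi> (Some a)) u (b # v) + ?T (tail \<phi> (Some b)) (a # u) v
      + ?T (tail \<phi> (d a b)) u v)"
    by (simp only: quasi_shuffle_Cons[of d a u b v] ext_add step opt Cons.IH distrib_left ac_simps)
  moreover have "?T \<phi> (a # u) (b # v) = \<phi> [] * ext \<psi> (?S (a # u) (b # v))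
      + (?T (tail \<phi> (Some a)) u (b # v) + ?T (tail \<phi> (Some b)) (a # u) v
      + ?T (tail \<phi> (d a b)) u v)"
    by (simp add: quasi_shuffle_Cons[of d a _ b] ext_prepend
        tail tail_Some split_sum_add distrib_right add_ac)
  ultimately show ?case by simp
qed (simp_all add: conv_def)

end


section \<open>Stuffle regularisation\<close>

context rat_algebra
begin

text \<open>The deconcatenation formula gives products of four factors, two from
  \<open>\<phi>\<close> and two from \<open>\<psi>\<close>; in a commutative ring they regroup into
  a product of two convolutions.\<close>

lemma multiplicative_conv:
  assumes "multiplicative d \<phi>" "multiplicative d \<psi>"
  shows "multiplicative d (conv \<phi> \<psi>)"
proof -
  have "split_sum (\<lambda>u1 u2. split_sum (\<lambda>v1 v2. (\<phi> u1 * \<phi> v1) * (\<psi> u2 * \<psi> v2)) v) u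
      = conv \<phi> \<psi> u * conv \<phi> \<psi> v" for u v
  proof -
    have "split_sum (\<lambda>v1 v2. (\<phi> u1 * \<phi> v1) * (\<psi> u2 * \<psi> v2)) v
        = (\<phi> u1 * \<psi> u2) * conv \<phi> \<psi> v" for u1 u2
      unfolding conv_def split_sum_mult_left[symmetric] by (rule split_sum_cong) (simp add: ac_simps)
    then show ?thesis by (simp add: split_sum_mult_right) (simp add: conv_def)
  qed
  with assms show ?thesis
    by (simp add: multiplicative_def ext_conv_quasi_shuffle)
qed

end

section \<open>Series in y_1 alone\<close>

definition ones_series :: "(nat \<Rightarrow> 'r) \<Rightarrow> nat list \<Rightarrow> 'r::zero" where
  "ones_series e w = (if w = replicate (length w) 1 then e (length w) else 0)"

lemma ones_series_Nil [simp]: "ones_series e [] = e 0"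
  by (simp add: ones_series_def)

lemma ones_series_Cons:
  "ones_series e (a # w) = (if a = 1 then ones_series (\<lambda>n. e (Suc n)) w else 0)"
  by (auto simp: ones_series_def)

lemma ones_series_eq_0: "set w \<inter> {a. a \<noteq> 1} \<noteq> {} \<Longrightarrow> ones_series e w = 0"
  by (induction w arbitrary: e) (auto simp: ones_series_Cons)

text \<open>Only prefixes consisting of ones contribute, and the condition on \<open>v\<close> stops
  the run at length \<open>m\<close>.\<close>

lemma conv_ones_series:
  assumes "v = [] \<or> hd v \<noteq> 1"
  shows "conv (ones_series e) z (replicate m 1 @ v) = (\<Sum>i\<le>m. e i * z (replicate (m - i) 1 @ v))"
proof (induction m arbitrary: e)
  case 0
  then show ?case using assms by (cases v) (auto simp: conv_Cons ones_series_Cons conv_def)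
next
  case (Suc m)
  then show ?case by (simp add: conv_Cons ones_series_Cons sum.atMost_Suc_shift del: sum.atMost_Suc)
qed

section \<open>Newton's identity in the quasi-shuffle algebra\<close>

definition insertions :: "nat \<Rightarrow> nat \<Rightarrow> nat ncpoly" where
  "insertions k m = (\<Sum>a\<le>m. word (replicate a 1 @ k # replicate (m - a) 1))"

lemma insertions_0 [simp]: "insertions k 0 = word [k]"
  by (simp add: insertions_def)

lemma insertions_Suc: "insertions k (Suc m) = word (k # replicate (Suc m) 1) + prepend 1 (insertions k m)"
  by (simp add: insertions_def sum.atMost_Suc_shift prepend_sum del: sum.atMost_Suc)

lemma insertions_1: "insertions 1 m = scale (of_nat (Suc m)) (word (replicate (Suc m) 1))"
  by (induction m) (simp_all add: insertions_Suc single_add[symmetric])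

text \<open>The letter y_k stays apart or merges with one of the ones. For \<open>k \<ge> 2\<close>,
  \<open>insertions k m\<close> is the monomial symmetric function of shape (k, 1^m), and this
  expands the product of a power sum with an elementary symmetric function.\<close>

lemma quasi_shuffle_single_ones:
  assumes "k \<ge> 1"
  shows "quasi_shuffle balanced_letters [k] (replicate m 1) =
    insertions k m + (if m = 0 then 0 else insertions (Suc k) (m - 1))"
proof (induction m)
  case (Suc m)
  have "balanced_letters k 1 = Some (Suc k)"
    using assms by (simp add: balanced_letters_def)
  then have "quasi_shuffle balanced_letters [k] (replicate (Suc m) 1) =
      word (k # replicate (Suc m) 1)
      + prepend 1 (quasi_shuffle balanced_letters [k] (replicate m 1))
      + word (Suc k # replicate m 1)"
    by (simp add: quasi_shuffle_Cons[of _ k])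
  then show ?case
    unfolding Suc.IH by (cases m) (simp_all add: insertions_Suc algebra_simps)
qed simp

text \<open>Newton's identity between the elementary symmetric functions \<open>y\<^sub>1\<^bsup>n\<^esup>\<close> and the power sums
  \<open>y\<^sub>k\<close>. The sum telescopes.\<close>

lemma newton_identity:
  assumes "n \<ge> 1"
  shows "scale (of_nat n) (word (replicate n 1)) =
    (\<Sum>k=1..n. scale ((-1) ^ (k - 1)) (quasi_shuffle balanced_letters [k] (replicate (n - k) 1)))"
proof -
  \<comment> \<open>Partial sums are evaluated: apart from \<open>insertions 1\<close>, each
    insertion sum occurs in two consecutive terms with opposite signs, so only the first one and,
    before the end, the latest one remain.\<close>
  have "(\<Sum>k=1..j. scale ((-1) ^ (k - 1)) (quasi_shuffle balanced_letters [k] (replicate (n - k) 1)))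
      = insertions 1 (n - 1)
        + (if j < n then scale ((-1) ^ (j - 1)) (insertions (Suc j) (n - 1 - j)) else 0)"
    if "1 \<le> j" "j \<le> n" for j
    using that
  proof (induction j rule: nat_induct_at_least)
    case base
    then show ?case by (auto simp: quasi_shuffle_single_ones[unfolded One_nat_def])
  next
    case (Suc j)
    then obtain i where j: "j = Suc i" by (cases j) auto
    have eq: "scale ((-1) ^ i) P + (scale (- ((-1) ^ i)) P + R) = R" for P R :: "nat ncpoly"
      by (metis add.assoc add.left_neutral add.right_inverse scale_add_left scale_zero_left)
    show ?case using Suc
      by (auto simp: quasi_shuffle_single_ones[unfolded One_nat_def] j eq add.assoc)
  qed
  from this[of n] assms insertions_1[of "n - 1"] show ?thesis by simp
qed

text \<open>Triangularity: the product of \<open>v\<close> with y_1^m is y_1^m \<open>v\<close> up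
  to words with a shorter leading run of y_1.\<close>

lemma keys_quasi_shuffle_ones:
  assumes "v = [] \<or> hd v \<noteq> 1"
    and "w \<in> Poly_Mapping.keys (quasi_shuffle balanced_letters v (replicate m 1) - word (replicate m 1 @ v))"
  obtains j v' where "j < m" "v' = [] \<or> hd v' \<noteq> 1" "w = replicate j 1 @ v'"
proof -
  have "\<exists>j v'. j < m \<and> (v' = [] \<or> hd v' \<noteq> 1) \<and> w = replicate j 1 @ v'"
    using assms(2)
  proof (induction m arbitrary: w)
    case (Suc m)
    show ?case
    proof (cases v)
      case Nil
      then show ?thesis using Suc.prems by simp
    next
      case (Cons b u)
      with assms(1) have b: "b \<noteq> 1" by simp
      let ?D = "quasi_shuffle balanced_letters v (replicate m 1) - word (replicate m 1 @ v)"
      let ?P = "prepend b (quasi_shuffle balanced_letters u (1 # replicate m 1))"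
      let ?R = "prepend_opt (balanced_letters b 1) (quasi_shuffle balanced_letters u (replicate m 1))"
      have "prepend 1 ?D = prepend 1 (quasi_shuffle balanced_letters v (replicate m 1)) - word (1 # replicate m 1 @ v)"
        using prepend_simps(1)[of 1 ?D "word (replicate m 1 @ v)"] by (simp add: algebra_simps)
      then have "quasi_shuffle balanced_letters v (replicate (Suc m) 1) - word (replicate (Suc m) 1 @ v)
          = ?P + prepend 1 ?D + ?R"
        by (simp add: Cons quasi_shuffle_Cons algebra_simps)
      with Suc.prems have "w \<in> Poly_Mapping.keys (?P + prepend 1 ?D + ?R)" by simp
      then consider "w \<in> Poly_Mapping.keys ?P" | "w \<in> Poly_Mapping.keys (prepend 1 ?D)"
        | "w \<in> Poly_Mapping.keys ?R"
        using keys_add by (metis Un_iff subsetD)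
      then show ?thesis
      proof cases
        case 1
        with keys_prepend have "w \<noteq> [] \<and> hd w = b" by fastforce
        with b show ?thesis by (intro exI[of _ 0] exI[of _ w]) auto
      next
        case 2
        then obtain w' where "w = 1 # w'" "w' \<in> Poly_Mapping.keys ?D"
          using keys_prepend by (metis (no_types, lifting) imageE subsetD)
        with Suc.IH obtain j v' where "j < m" "v' = [] \<or> hd v' \<noteq> 1" "w' = replicate j 1 @ v'"
          by blast
        with \<open>w = 1 # w'\<close> show ?thesis by (intro exI[of _ "Suc j"] exI[of _ v']) auto
      next
        \<comment> \<open>The merged letter \<open>b + 1\<close> with \<open>b \<ge> 1\<close> is
          again not y_1, so the leading run is empty.\<close>
        case 3
        then have "b \<ge> 1" "w \<in> Poly_Mapping.keys
            (prepend (b + 1) (quasi_shuffle balanced_letters u (replicate m 1)))"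
          by (auto simp: balanced_letters_def split: if_splits)
        with keys_prepend have "w \<noteq> [] \<and> hd w = b + 1" by fastforce
        with \<open>b \<ge> 1\<close> show ?thesis by (intro exI[of _ 0] exI[of _ w]) auto
      qed
    qed
  qed simp
  then show ?thesis using that by blast
qed

text \<open>The algebra is polynomial in \<open>y\<^sub>1\<close> over the span of the words not starting with \<open>y\<^sub>1\<close>; here the
  words \<open>y\<^sub>1\<^bsup>n\<^esup>\<close> replace the powers of \<open>y\<^sub>1\<close>.\<close>

lemma regularisation_induct [case_names gen add scale]:
  assumes gen: "\<And>v n. v = [] \<or> hd v \<noteq> 1 \<Longrightarrow> \<Phi> (quasi_shuffle balanced_letters v (replicate n 1))"
    and add: "\<And>P Q. \<Phi> P \<Longrightarrow> \<Phi> Q \<Longrightarrow> \<Phi> (P + Q)"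
    and scale: "\<And>c P. \<Phi> P \<Longrightarrow> \<Phi> (scale c P)"
  shows "\<Phi> P"
proof -
  have "\<Phi> (word (replicate m 1 @ v))" if "v = [] \<or> hd v \<noteq> 1" for m v
    using that
  proof (induction m arbitrary: v rule: less_induct)
    case (less m)
    let ?Q = "quasi_shuffle balanced_letters v (replicate m 1)"
    let ?D = "?Q - word (replicate m 1 @ v)"
    have zero: "\<Phi> 0" using scale[OF gen[of "[]" 0], of 0] by simp
    have key: "\<Phi> (word w)" if "w \<in> Poly_Mapping.keys ?D" for w
      using keys_quasi_shuffle_ones[OF less.prems that] less.IH by metis
    have "\<Phi> (\<Sum>w\<in>A. scale (Poly_Mapping.lookup ?D w) (word w))"
      if "A \<subseteq> Poly_Mapping.keys ?D" for A
      using that by (induction A rule: infinite_finite_induct)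
        (auto simp del: scale_single simp: zero intro!: add scale key)
    from this[OF order.refl] have "\<Phi> ?D" by (simp only: ncpoly_as_sum[symmetric])
    \<comment> \<open>The word is the product minus the terms with shorter leading runs, which the
      induction covers.\<close>
    then have "\<Phi> (?Q + scale (-1) ?D)" using add gen scale less.prems by blast
    then show ?case by (simp add: scale_minus_one)
  qed
  moreover have "\<exists>m v. (v = [] \<or> hd v \<noteq> 1) \<and> w = replicate m 1 @ v" for w :: "nat list"
  proof (induction w)
    case (Cons a w)
    then obtain m v where "v = [] \<or> hd v \<noteq> 1" "w = replicate m 1 @ v" by blast
    then show ?case
      by (cases "a = 1") (force intro: exI[of _ "Suc m"] exI[of _ v], force intro: exI[of _ 0])
  qed simp
  ultimately have "\<Phi> (word w)" for w by metis
  then show ?thesis by (induction P rule: ncpoly_induct) (auto intro: add scale)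
qed

text \<open>\<open>z\<close> stands for the values before correction, multiplicative only against
  words not starting with y_1, and \<open>e\<close> for the coefficients of the correction series.
  The recursion \<open>e_rec\<close> is the differential equation of the exponential.\<close>

locale stuffle_regularisation = rat_algebra q for q :: "rat \<Rightarrow> 'r::comm_ring_1" +
  fixes z :: "nat list \<Rightarrow> 'r" and e :: "nat \<Rightarrow> 'r"
  assumes z_Nil: "z [] = 1"
    and z_ones: "n > 0 \<Longrightarrow> z (replicate n 1) = 0"
    and z_mult: "u = [] \<or> hd u \<noteq> 1 \<Longrightarrow> ext z (quasi_shuffle balanced_letters u v) = z u * z v"
    and e_0: "e 0 = 1"
    and e_rec: "n > 0 \<Longrightarrow> of_nat n * e n = (\<Sum>k=2..n. (-1) ^ (k - 1) * z [k] * e (n - k))"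
begin

definition reg :: "nat list \<Rightarrow> 'r" where
  "reg = conv (ones_series e) z"

lemma reg_ones: "reg (replicate n 1) = e n"
proof -
  have "reg (replicate n 1) = (\<Sum>i\<le>n. e i * z (replicate (n - i) 1))"
    using conv_ones_series[of "[]" e z n] by (simp add: reg_def)
  also have "\<dots> = (\<Sum>i\<le>n. if i = n then e n else 0)"
    by (rule sum.cong) (auto simp: z_ones z_Nil simp del: One_nat_def)
  finally show ?thesis by simp
qed

text \<open>In the deconcatenation formula a nonempty prefix of \<open>u\<close> contains a letter
  other than y_1, which survives in every term and is killed by \<open>ones_series\<close>. Only the
  empty prefix remains.\<close>

lemma ext_reg_mult_word:
  assumes "u = [] \<or> hd u \<noteq> 1"
  shows "ext reg (quasi_shuffle balanced_letters u v) = z u * reg v"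
proof (cases u)
  case (Cons a u')
  with assms have "a \<noteq> 1" by simp
  have "ext (ones_series e) (quasi_shuffle balanced_letters (a # u1) v1) = 0" for u1 v1
  proof (rule ext_eq_0)
    fix w assume "w \<in> Poly_Mapping.keys (quasi_shuffle balanced_letters (a # u1) v1)"
    then have "set w \<inter> {a. a \<noteq> 1} \<noteq> {}"
      by (rule quasi_shuffle_meets[rotated 2])
        (use \<open>a \<noteq> 1\<close> in \<open>auto simp: balanced_letters_def split: if_splits\<close>)
    then show "ones_series e w = 0" by (rule ones_series_eq_0)
  qed
  then show ?thesis
    using z_mult[OF assms] unfolding reg_def ext_conv_quasi_shuffle Cons
    by (simp add: mult.left_commute[of _ "z (a # u')"] split_sum_mult_left conv_def)
qed (simp add: z_Nil)

lemma ext_reg_mult: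
  assumes "u = [] \<or> hd u \<noteq> 1"
  shows "ext reg (qmul balanced_letters (word u) P) = z u * ext reg P"
  by (induction P rule: ncpoly_induct)
    (simp_all add: ext_reg_mult_word[OF assms] algebra_simps)

text \<open>Newton's identity multiplied by \<open>P\<close>. For \<open>k \<ge> 2\<close> the
  factor y_k comes out as \<open>z [k]\<close>; the term with y_1 is kept apart, its value still
  being unknown.\<close>

lemma newton_reg:
  assumes "n > 0"
  shows "of_nat n * ext reg (qmul balanced_letters (word (replicate n 1)) P) =
    ext reg (qmul balanced_letters (word [1]) (qmul balanced_letters (word (replicate (n - 1) 1)) P))
    + (\<Sum>k=2..n. (-1) ^ (k - 1) * z [k] * ext reg (qmul balanced_letters (word (replicate (n - k) 1)) P))"
proof -
  let ?f = "\<lambda>k. (-1) ^ (k - 1) *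
    ext reg (qmul balanced_letters (word [k]) (qmul balanced_letters (word (replicate (n - k) 1)) P))"
  have "of_nat n * ext reg (qmul balanced_letters (word (replicate n 1)) P) =
      ext reg (qmul balanced_letters (scale (of_nat n) (word (replicate n 1))) P)"
    by (simp only: qmul_simps ext_scale q_of_nat)
  also have "\<dots> = (\<Sum>k=1..n. ?f k)"
    using assms by (subst newton_identity)
      (simp_all add: qmul_sum_left ext_sum q_power q_minus q_1 flip: balanced.qmul_assoc)
  also have "\<dots> = ?f 1 + (\<Sum>k=2..n. ?f k)"
    using assms by (simp add: sum.atLeast_Suc_atMost numeral_2_eq_2)
  also have "(\<Sum>k=2..n. ?f k) =
      (\<Sum>k=2..n. (-1) ^ (k - 1) * z [k] * ext reg (qmul balanced_letters (word (replicate (n - k) 1)) P))"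
    by (rule sum.cong) (simp_all add: ext_reg_mult mult.assoc)
  finally show ?thesis by simp
qed

lemma ext_reg_mult_one: "ext reg (qmul balanced_letters (word [1]) P) = 0"
proof (induction P rule: regularisation_induct)
  case (gen v n)
  \<comment> \<open>For \<open>P\<close> the unit, the terms \<open>k \<ge> 2\<close> of Newton's
    identity are those of the recursion for \<open>e\<close>. Only the term with y_1 is left over,
    so it vanishes.\<close>
  have "of_nat (Suc n) * e (Suc n) = ext reg (quasi_shuffle balanced_letters [1] (replicate n 1))
      + of_nat (Suc n) * e (Suc n)"
    using newton_reg[of "Suc n" "word []"] e_rec[of "Suc n"] by (simp add: reg_ones del: of_nat_Suc replicate_Suc One_nat_def sum.cl_ivl_Suc)
  then have zero: "ext reg (quasi_shuffle balanced_letters [1] (replicate n 1)) = 0" by simp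
  have "qmul balanced_letters (word [1]) (quasi_shuffle balanced_letters v (replicate n 1)) =
      qmul balanced_letters (word v) (quasi_shuffle balanced_letters [1] (replicate n 1))"
    using balanced.qmul_left_commute[of "word [1]" "word v" "word (replicate n 1)"] by simp
  then show ?case using zero by (simp add: ext_reg_mult[OF gen])
qed simp_all

text \<open>With the y_1 term gone, Newton's identity becomes the recursion for \<open>e\<close>,
  and \<open>n\<close> can be cancelled over the rationals.\<close>

lemma ext_reg_mult_ones: "ext reg (qmul balanced_letters (word (replicate n 1)) P) = e n * ext reg P"
proof (induction n rule: less_induct)
  case (less n)
  show ?case
  proof (cases "n = 0")
    case False
    then have "of_nat n * ext reg (qmul balanced_letters (word (replicate n 1)) P) =
        (\<Sum>k=2..n. (-1) ^ (k - 1) * z [k] * e (n - k)) * ext reg P"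
      by (simp add: newton_reg ext_reg_mult_one less.IH sum_distrib_right mult.assoc del: One_nat_def)
    also have "\<dots> = of_nat n * (e n * ext reg P)"
      using False by (subst e_rec[symmetric]) (simp_all add: mult.assoc)
    finally show ?thesis using of_nat_cancel[of n] False by blast
  qed (simp add: e_0)
qed

text \<open>On a product of \<open>v\<close> with y_1^n both factors come out, as \<open>z v\<close>
  and \<open>e n\<close>, for an arbitrary second argument.\<close>

theorem multiplicative_reg: "multiplicative balanced_letters reg"
proof -
  have "ext reg (qmul balanced_letters P Q) = ext reg P * ext reg Q" for P Q
  proof (induction P rule: regularisation_induct)
    case (gen v n)
    have "qmul balanced_letters (quasi_shuffle balanced_letters v (replicate n 1)) Q =
        qmul balanced_letters (word v) (qmul balanced_letters (word (replicate n 1)) Q)"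
      using balanced.qmul_assoc[of "word v" "word (replicate n 1)" Q] by simp
    then show ?case
      by (simp add: ext_reg_mult[OF gen] ext_reg_mult_word[OF gen] ext_reg_mult_ones reg_ones mult.assoc del: One_nat_def)
  qed (simp_all add: algebra_simps)
  from this[of "word u" "word v" for u v] show ?thesis
    by (simp add: multiplicative_def)
qed

end


section \<open>Quotient algebras\<close>

lemma quot_algebra_simps:
  "carrier (quot_algebra A I) = carrier (A Quot I)"
  "monoid.mult (quot_algebra A I) = monoid.mult (A Quot I)"
  "one (quot_algebra A I) = one (A Quot I)"
  "zero (quot_algebra A I) = zero (A Quot I)"
  "add (quot_algebra A I) = add (A Quot I)"
  by (simp_all add: quot_algebra_def)

lemma cring_quot_algebra:
  assumes "cring A" "ideal I A"
  shows "cring (quot_algebra A I)"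
proof -
  interpret Q: cring "A Quot I"
    by (rule ideal.quotient_is_cring) (rule assms)+
  show ?thesis
  proof (rule cringI)
    show "abelian_group (quot_algebra A I)"
    proof (rule abelian_groupI)
      fix x assume "x \<in> carrier (quot_algebra A I)"
      then show "\<exists>y\<in>carrier (quot_algebra A I). y \<oplus>\<^bsub>quot_algebra A I\<^esub> x = \<zero>\<^bsub>quot_algebra A I\<^esub>"
        using Q.l_neg Q.a_inv_closed by (auto simp: quot_algebra_simps)
    qed (simp_all add: quot_algebra_simps Q.a_ac)
    show "comm_monoid (quot_algebra A I)"
      by (rule comm_monoidI) (simp_all add: quot_algebra_simps Q.m_ac)
  qed (simp add: quot_algebra_simps Q.l_distr)
qed

context
  fixes K :: "'k ring" and A :: "('k, 'a) module" and I :: "'a set"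
  assumes A: "algebra K A" and I: "ideal I A"
begin

interpretation A: algebra K A by (rule A)
interpretation I: ideal I A by (rule I)

lemma carrier_quot_algebra: "carrier (quot_algebra A I) = (\<lambda>a. I +>\<^bsub>A\<^esub> a) ` carrier A"
  by (auto simp: quot_algebra_simps FactRing_simps)

lemma one_quot_algebra: "\<one>\<^bsub>quot_algebra A I\<^esub> = I +>\<^bsub>A\<^esub> \<one>\<^bsub>A\<^esub>"
  by (simp add: quot_algebra_simps FactRing_simps)

lemma zero_quot_algebra: "\<zero>\<^bsub>quot_algebra A I\<^esub> = I"
  by (simp add: quot_algebra_simps FactRing_simps)

lemma add_quot_algebra:
  assumes "x \<in> carrier A" "y \<in> carrier A"
  shows "(I +>\<^bsub>A\<^esub> x) \<oplus>\<^bsub>quot_algebra A I\<^esub> (I +>\<^bsub>A\<^esub> y) = I +>\<^bsub>A\<^esub> (x \<oplus>\<^bsub>A\<^esub> y)"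
  using assms by (simp add: quot_algebra_simps FactRing_simps I.a_rcos_sum)

lemma mult_quot_algebra:
  assumes "x \<in> carrier A" "y \<in> carrier A"
  shows "(I +>\<^bsub>A\<^esub> x) \<otimes>\<^bsub>quot_algebra A I\<^esub> (I +>\<^bsub>A\<^esub> y) = I +>\<^bsub>A\<^esub> (x \<otimes>\<^bsub>A\<^esub> y)"
  using assms by (simp add: quot_algebra_simps FactRing_simps I.rcoset_mult_add)

text \<open>A scalar acts as multiplication by a multiple of the unit, so ring ideals are
  subspaces.\<close>

lemma ideal_smult_closed:
  assumes "c \<in> carrier K" "x \<in> I"
  shows "c \<odot>\<^bsub>A\<^esub> x \<in> I"
proof -
  have "(c \<odot>\<^bsub>A\<^esub> \<one>\<^bsub>A\<^esub>) \<otimes>\<^bsub>A\<^esub> x = c \<odot>\<^bsub>A\<^esub> x"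
    using assms I.a_Hcarr by (simp add: A.smult_assoc2)
  then show ?thesis
    using I.I_l_closed[OF assms(2), of "c \<odot>\<^bsub>A\<^esub> \<one>\<^bsub>A\<^esub>"] assms by simp
qed

text \<open>All representatives give the same coset after scaling, so the union defining the scalar
  action is a single coset.\<close>

lemma smult_quot_algebra:
  assumes c: "c \<in> carrier K" and x: "x \<in> carrier A"
  shows "c \<odot>\<^bsub>quot_algebra A I\<^esub> (I +>\<^bsub>A\<^esub> x) = I +>\<^bsub>A\<^esub> (c \<odot>\<^bsub>A\<^esub> x)"
proof -
  have "I +>\<^bsub>A\<^esub> (c \<odot>\<^bsub>A\<^esub> y) = I +>\<^bsub>A\<^esub> (c \<odot>\<^bsub>A\<^esub> x)" if y: "y \<in> I +>\<^bsub>A\<^esub> x" for y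
  proof -
    obtain h where h: "h \<in> I" "y = h \<oplus>\<^bsub>A\<^esub> x"
      using y unfolding a_r_coset_def' by blast
    from h(1) have "c \<odot>\<^bsub>A\<^esub> y = c \<odot>\<^bsub>A\<^esub> h \<oplus>\<^bsub>A\<^esub> c \<odot>\<^bsub>A\<^esub> x"
      unfolding h(2) by (intro A.smult_r_distr c x I.a_Hcarr)
    then have "c \<odot>\<^bsub>A\<^esub> y \<in> I +>\<^bsub>A\<^esub> (c \<odot>\<^bsub>A\<^esub> x)"
      using ideal_smult_closed[OF c h(1)] unfolding a_r_coset_def' by blast
    from I.a_repr_independence'[OF this] show ?thesis using c x by simp
  qed
  moreover have "x \<in> I +>\<^bsub>A\<^esub> x" using x by (rule I.a_rcos_self)
  ultimately have "(\<Union>y\<in>I +>\<^bsub>A\<^esub> x. I +>\<^bsub>A\<^esub> (c \<odot>\<^bsub>A\<^esub> y)) = I +>\<^bsub>A\<^esub> (c \<odot>\<^bsub>A\<^esub> x)"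
    by blast
  then show ?thesis by (simp add: quot_algebra_def)
qed

lemma coset_self: "x \<in> carrier A \<Longrightarrow> x \<in> I +>\<^bsub>A\<^esub> x"
  by (rule I.a_rcos_self)

lemma coset_eq_ideal: "x \<in> I \<Longrightarrow> I +>\<^bsub>A\<^esub> x = I"
  by (rule I.a_rcos_const)

lemma algebra_quot_algebra: "algebra K (quot_algebra A I)"
  by (rule algebraI[OF A.R_cring cring_quot_algebra[OF A.M_cring I]])
    (auto simp: carrier_quot_algebra smult_quot_algebra add_quot_algebra mult_quot_algebra
      A.smult_l_distr A.smult_r_distr A.smult_assoc1 A.smult_assoc2)

end

context quasi_shuffle_algebra
begin

lemma ideal_qsh_algebraI:
  assumes "0 \<in> J" and "\<And>P Q. P \<in> J \<Longrightarrow> Q \<in> J \<Longrightarrow> P + Q \<in> J"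
    and mult: "\<And>P Q. Q \<in> J \<Longrightarrow> qmul d P Q \<in> J"
  shows "ideal J (qsh_algebra d)"
proof (rule idealI)
  interpret cring "qsh_algebra d" by (rule cring_qsh_algebra)
  show "ring (qsh_algebra d)" by (rule ring_axioms)
  have inv: "\<ominus>\<^bsub>qsh_algebra d\<^esub> P = - P" for P
    using minus_equality[of "-P" P] by simp
  show "subgroup J (add_monoid (qsh_algebra d))"
  proof (rule add.subgroupI)
    fix P assume "P \<in> J"
    then have "qmul d (- word []) P \<in> J" by (rule mult)
    then show "\<ominus>\<^bsub>qsh_algebra d\<^esub> P \<in> J" by (simp add: inv)
  qed (use assms in auto)
qed (use mult qmul_commute in auto)

lemma genideal_subsetI:
  assumes "S \<subseteq> J" "0 \<in> J" and "\<And>P Q. P \<in> J \<Longrightarrow> Q \<in> J \<Longrightarrow> P + Q \<in> J"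
    and "\<And>P Q. Q \<in> J \<Longrightarrow> qmul d P Q \<in> J"
  shows "Idl\<^bsub>qsh_algebra d\<^esub> S \<subseteq> J"
proof (rule ring.genideal_minimal)
  show "ring (qsh_algebra d)" by (rule cring.axioms(1)[OF cring_qsh_algebra])
  show "ideal J (qsh_algebra d)" by (rule ideal_qsh_algebraI) (use assms in auto)
qed fact

lemma ideal_genideal: "ideal (Idl\<^bsub>qsh_algebra d\<^esub> S) (qsh_algebra d)"
  by (rule ring.genideal_ideal[OF cring.axioms(1)[OF cring_qsh_algebra]]) simp

lemma genideal_superset: "S \<subseteq> Idl\<^bsub>qsh_algebra d\<^esub> S"
  by (rule ring.genideal_self[OF cring.axioms(1)[OF cring_qsh_algebra]]) simp

end

lemma ideal_Gf: "ideal Gf_ideal balanced_algebra"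
  unfolding Gf_ideal_def by (rule balanced.ideal_genideal)

lemma ideal_Zf: "ideal Zf_ideal shuffle_algebra"
  unfolding Zf_ideal_def by (rule shuffle.ideal_genideal)

lemma algebra_Gf: "algebra QQ Gf"
  unfolding Gf_def by (rule algebra_quot_algebra[OF balanced.algebra_qsh_algebra ideal_Gf])

lemma algebra_Zf: "algebra QQ Zf"
  unfolding Zf_def by (rule algebra_quot_algebra[OF shuffle.algebra_qsh_algebra ideal_Zf])

lemmas Gf_simps =
  carrier_quot_algebra[OF balanced.algebra_qsh_algebra ideal_Gf, folded Gf_def]
  one_quot_algebra[OF balanced.algebra_qsh_algebra ideal_Gf, folded Gf_def]
  zero_quot_algebra[OF balanced.algebra_qsh_algebra ideal_Gf, folded Gf_def]
  add_quot_algebra[OF balanced.algebra_qsh_algebra ideal_Gf, folded Gf_def]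
  mult_quot_algebra[OF balanced.algebra_qsh_algebra ideal_Gf, folded Gf_def]
  smult_quot_algebra[OF balanced.algebra_qsh_algebra ideal_Gf, folded Gf_def]

lemmas Zf_simps =
  carrier_quot_algebra[OF shuffle.algebra_qsh_algebra ideal_Zf, folded Zf_def]
  one_quot_algebra[OF shuffle.algebra_qsh_algebra ideal_Zf, folded Zf_def]
  zero_quot_algebra[OF shuffle.algebra_qsh_algebra ideal_Zf, folded Zf_def]
  add_quot_algebra[OF shuffle.algebra_qsh_algebra ideal_Zf, folded Zf_def]
  mult_quot_algebra[OF shuffle.algebra_qsh_algebra ideal_Zf, folded Zf_def]
  smult_quot_algebra[OF shuffle.algebra_qsh_algebra ideal_Zf, folded Zf_def]

lemma carrier_QQ [simp]: "c \<in> carrier QQ"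
  by (simp add: ring_of_type_algebra_def)

section \<open>The constant term and properness of the double shuffle ideal\<close>

lemma lookup_lin_ext_Nil:
  assumes "\<And>w. f w = [] \<longleftrightarrow> w = []"
  shows "Poly_Mapping.lookup (lin_ext (\<lambda>w. word (f w)) P) [] = Poly_Mapping.lookup P []"
  by (induction P rule: ncpoly_induct) (simp_all add: lookup_single lookup_add assms when_def)

lemma lookup_prepend_Nil [simp]: "Poly_Mapping.lookup (prepend a P) [] = 0"
  by (induction P rule: ncpoly_induct) (simp_all add: lookup_single lookup_add when_def)

lemma lookup_quasi_shuffle_Nil:
  "Poly_Mapping.lookup (quasi_shuffle d u v) [] = (if u = [] \<and> v = [] then 1 else 0)"
proof (cases u; cases v)
  fix a u' b v' assume "u = a # u'" "v = b # v'"
  then show ?thesis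
    by (cases "d a b") (simp_all add: quasi_shuffle_Cons lookup_add)
qed (simp_all add: lookup_single when_def)

lemma lookup_qmul_Nil:
  "Poly_Mapping.lookup (qmul d P Q) [] = Poly_Mapping.lookup P [] * Poly_Mapping.lookup Q []"
proof (induction P rule: ncpoly_induct)
  case (word u)
  show ?case
    by (induction Q rule: ncpoly_induct)
      (simp_all add: lookup_quasi_shuffle_Nil lookup_add lookup_single when_def algebra_simps)
qed (simp_all add: lookup_add algebra_simps)

text \<open>The constant term is multiplicative and vanishes on all relations, hence on the ideal.
  This gives \<open>0 \<noteq> 1\<close> in the type \<open>zf\<close>.\<close>

lemma word_Nil_notin_Zf_ideal: "word [] \<notin> Zf_ideal"
proof -
  have x_word_Nil: "x_word w = [] \<longleftrightarrow> w = []" for w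
    by (cases w) (simp_all add: x_word_def)
  have "Zf_ideal \<subseteq> {P. Poly_Mapping.lookup P [] = 0}"
    unfolding Zf_ideal_def
  proof (rule shuffle.genideal_subsetI)
    show "eds_relations \<subseteq> {P. Poly_Mapping.lookup P [] = 0}"
      by (auto simp: eds_relations_def lookup_minus lookup_lin_ext_Nil x_word_Nil lookup_quasi_shuffle_Nil
          lookup_single when_def)
  qed (simp_all add: lookup_add lookup_qmul_Nil)
  then show ?thesis by auto
qed


section \<open>Formal multiple zeta values as a type\<close>

interpretation Zf: algebra QQ Zf by (rule algebra_Zf)

text \<open>As a type, the carrier admits ordinary sums, formal power series and the results on
  \<open>rat_algebra\<close>; \<open>Rep_zf\<close> leads back to cosets.\<close>

typedef zf = "carrier Zf"
  using Zf.zero_closed by blast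

setup_lifting type_definition_zf

instantiation zf :: comm_ring_1
begin

lift_definition zero_zf :: zf is "\<zero>\<^bsub>Zf\<^esub>" by simp
lift_definition one_zf :: zf is "\<one>\<^bsub>Zf\<^esub>" by simp
lift_definition plus_zf :: "zf \<Rightarrow> zf \<Rightarrow> zf" is "\<lambda>a b. a \<oplus>\<^bsub>Zf\<^esub> b" by simp
lift_definition times_zf :: "zf \<Rightarrow> zf \<Rightarrow> zf" is "\<lambda>a b. a \<otimes>\<^bsub>Zf\<^esub> b" by simp
lift_definition uminus_zf :: "zf \<Rightarrow> zf" is "\<lambda>a. \<ominus>\<^bsub>Zf\<^esub> a" by simp
definition minus_zf :: "zf \<Rightarrow> zf \<Rightarrow> zf" where "a - b = a + (- b)" for a b :: zf

instance
proof
  fix a b c :: zf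
  show "a + b + c = a + (b + c)" by transfer (rule Zf.a_assoc)
  show "a + b = b + a" by transfer (rule Zf.a_comm)
  show "0 + a = a" by transfer (rule Zf.l_zero)
  show "- a + a = 0" by transfer (rule Zf.l_neg)
  show "a - b = a + - b" by (rule minus_zf_def)
  show "a * b * c = a * (b * c)" by transfer (rule Zf.m_assoc)
  show "a * b = b * a" by transfer (rule Zf.m_comm)
  show "1 * a = a" by transfer (rule Zf.l_one)
  show "(a + b) * c = a * c + b * c" by transfer (rule Zf.l_distr)
  have "\<one>\<^bsub>Zf\<^esub> \<noteq> \<zero>\<^bsub>Zf\<^esub>"
  proof
    assume "\<one>\<^bsub>Zf\<^esub> = \<zero>\<^bsub>Zf\<^esub>"
    then have "Zf_ideal +>\<^bsub>shuffle_algebra\<^esub> word [] = Zf_ideal"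
      by (simp add: Zf_simps)
    moreover have "word [] \<in> Zf_ideal +>\<^bsub>shuffle_algebra\<^esub> word []"
      by (rule coset_self[OF shuffle.algebra_qsh_algebra ideal_Zf]) simp
    ultimately show False using word_Nil_notin_Zf_ideal by simp
  qed
  then show "0 \<noteq> (1 :: zf)" by transfer simp
qed

end

lemma Rep_zf_finsum:
  "finsum Zf (\<lambda>x. Rep_zf (f x)) A = Rep_zf (\<Sum>x\<in>A. f x)"
proof (induction A rule: infinite_finite_induct)
  \<comment> \<open>Sums over infinite index sets are zero by convention on both sides.\<close>
  case (infinite A)
  then show ?case by (simp add: finsum_def finprod_def zero_zf.rep_eq)
next
  case (insert x A)
  then show ?case by (simp add: Zf.finsum_insert Rep_zf Pi_iff plus_zf.rep_eq)
qed (simp add: zero_zf.rep_eq)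

lift_definition zf_class :: "xletter ncpoly \<Rightarrow> zf" is "\<lambda>P. Zf_ideal +>\<^bsub>shuffle_algebra\<^esub> P"
  by (simp add: Zf_simps)

lemma zf_class_add: "zf_class (P + Q) = zf_class P + zf_class Q"
  by transfer (simp add: Zf_simps)

lemma zf_class_mult: "zf_class (qmul shuffle_letters P Q) = zf_class P * zf_class Q"
  by transfer (simp add: Zf_simps)

lemma zf_class_one: "zf_class (word []) = 1"
  by transfer (simp add: Zf_simps)

lemma zf_class_eq_0: "P \<in> Zf_ideal \<Longrightarrow> zf_class P = 0"
  by transfer (simp add: Zf_simps coset_eq_ideal[OF shuffle.algebra_qsh_algebra ideal_Zf])

definition zf_rat :: "rat \<Rightarrow> zf" where
  "zf_rat c = zf_class (scale c (word []))"

interpretation zf: rat_algebra zf_rat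
proof
  fix x y
  show "zf_rat (x + y) = zf_rat x + zf_rat y"
    by (simp only: zf_rat_def scale_add_left zf_class_add)
  show "zf_rat (x * y) = zf_rat x * zf_rat y"
    by (simp only: zf_rat_def qmul_simps(3) qmul_one_left scale_scale flip: zf_class_mult)
  show "zf_rat 1 = 1"
    by (simp add: zf_rat_def zf_class_one)
qed

lemma zf_class_scale: "zf_class (scale c P) = zf_rat c * zf_class P"
proof -
  have "zf_rat c * zf_class P = zf_class (qmul shuffle_letters (scale c (word [])) P)"
    by (simp only: zf_rat_def zf_class_mult)
  then show ?thesis by (simp only: qmul_simps qmul_one_left)
qed

lemma Rep_zf_smult: "c \<odot>\<^bsub>Zf\<^esub> Rep_zf x = Rep_zf (zf_rat c * x)"
proof -
  have "Rep_zf x \<in> carrier Zf" by (rule Rep_zf)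
  then obtain P where "Rep_zf x = Zf_ideal +>\<^bsub>shuffle_algebra\<^esub> P"
    by (auto simp: Zf_simps)
  then have "x = zf_class P"
    by (simp flip: zf_class.rep_eq Rep_zf_inject)
  then show ?thesis by (simp add: zf_class.rep_eq Zf_simps flip: zf_class_scale)
qed

lemma zf_class_surj: "\<exists>P. x = zf_class P"
proof -
  have "Rep_zf x \<in> carrier Zf" by (rule Rep_zf)
  then show ?thesis
    by (auto simp: Zf_simps simp flip: zf_class.rep_eq Rep_zf_inject)
qed

lemma zf_class_eq_ext: "zf_class P = zf.ext (\<lambda>w. zf_class (word w)) P"
  by (induction P rule: ncpoly_induct) (simp_all add: zf_class_add zf_class_scale)


section \<open>The stuffle regularised formal multiple zeta values\<close>

context rat_algebra
begin

text \<open>Degree \<open>n\<close> coefficient of the exponential of the series with coefficients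
  \<open>c\<close>. Stopping at \<open>j = n\<close> loses nothing once
  \<open>c 0 = 0\<close>.\<close>

definition exp_coeff :: "(nat \<Rightarrow> 'r) \<Rightarrow> nat \<Rightarrow> 'r" where
  "exp_coeff c n = (\<Sum>j\<le>n. q (1 / fact j) * (Abs_fps c ^ j) $ n)"

lemma exp_coeff_0: "exp_coeff c 0 = 1"
  by (simp add: exp_coeff_def q_1)

lemma exp_coeff_extend:
  assumes "c 0 = 0" "n \<le> m"
  shows "(\<Sum>j\<le>m. q (1 / fact j) * (Abs_fps c ^ j) $ n) = exp_coeff c n"
  unfolding exp_coeff_def
  by (rule sum.mono_neutral_right) (use assms startsby_zero_power_prefix[of "Abs_fps c"] in auto)

text \<open>Comparison of the coefficients in \<open>E' = C' E\<close> for \<open>E = exp C\<close>.\<close>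

lemma exp_coeff_rec:
  assumes c0: "c 0 = 0" and "n > 0"
  shows "of_nat n * exp_coeff c n = (\<Sum>k=1..n. of_nat k * c k * exp_coeff c (n - k))"
proof -
  obtain m where n: "n = Suc m" using \<open>n > 0\<close> by (cases n) auto
  let ?C = "Abs_fps c"
  \<comment> \<open>Differentiation matches the term \<open>Suc j\<close> of E' with the term
    \<open>j\<close> of C' E; the factor \<open>Suc j\<close> is absorbed by the factorial.\<close>
  have pow: "q (1 / fact (Suc j)) * (of_nat n * (?C ^ Suc j) $ n) =
      q (1 / fact j) * (\<Sum>i\<le>m. of_nat (Suc i) * c (Suc i) * (?C ^ j) $ (m - i))" for j
  proof -
    have "of_nat n * (?C ^ Suc j) $ n = fps_deriv (?C ^ Suc j) $ m"
      by (simp only: fps_deriv_nth n Suc_eq_plus1)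
    also have "\<dots> = of_nat (Suc j) * (fps_deriv ?C * ?C ^ j) $ m"
      by (simp only: fps_deriv_power diff_Suc_1 mult.assoc fps_mult_left_const_nth)
    also have "(fps_deriv ?C * ?C ^ j) $ m = (\<Sum>i\<le>m. of_nat (Suc i) * c (Suc i) * (?C ^ j) $ (m - i))"
      by (simp add: fps_mult_nth atLeast0AtMost)
    finally have "q (1 / fact (Suc j)) * (of_nat n * (?C ^ Suc j) $ n) =
        q (1 / fact (Suc j) * of_nat (Suc j))
          * (\<Sum>i\<le>m. of_nat (Suc i) * c (Suc i) * (?C ^ j) $ (m - i))"
      by (simp only: q_mult q_of_nat mult.assoc)
    also have "1 / fact (Suc j) * of_nat (Suc j) = (1 / fact j :: rat)"
      by (simp del: of_nat_Suc)
    finally show ?thesis .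
  qed
  have "of_nat n * exp_coeff c n = (\<Sum>j\<le>n. q (1 / fact j) * (of_nat n * (?C ^ j) $ n))"
    by (simp add: exp_coeff_def sum_distrib_left mult.left_commute)
  also have "\<dots> = (\<Sum>j\<le>m. q (1 / fact (Suc j)) * (of_nat n * (?C ^ Suc j) $ n))"
    by (simp add: n sum.atMost_Suc_shift del: sum.atMost_Suc of_nat_Suc fact_Suc power_Suc)
  also have "\<dots> = (\<Sum>j\<le>m. \<Sum>i\<le>m. of_nat (Suc i) * c (Suc i) * (q (1 / fact j) * (?C ^ j) $ (m - i)))"
    by (simp only: pow sum_distrib_left) (simp only: ac_simps)
  also have "\<dots> = (\<Sum>i\<le>m. of_nat (Suc i) * c (Suc i) * (\<Sum>j\<le>m. q (1 / fact j) * (?C ^ j) $ (m - i)))"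
    by (subst sum.swap) (simp only: sum_distrib_left)
  also have "\<dots> = (\<Sum>i\<le>m. of_nat (Suc i) * c (Suc i) * exp_coeff c (m - i))"
    by (simp add: exp_coeff_extend c0)
  also have "\<dots> = (\<Sum>k=1..n. of_nat k * c k * exp_coeff c (n - k))"
    by (rule sum.reindex_bij_witness[of _ "\<lambda>k. k - 1" Suc]) (auto simp: n)
  finally show ?thesis .
qed

end

section \<open>Formal zeta values of words, and the data for the regularisation\<close>

definition zf_word :: "xletter list \<Rightarrow> zf" where
  "zf_word w = zf_class (word w)"

lemma zeta_sh_eq: "zeta_sh w = Rep_zf (zf_word w)"
  by (simp add: zeta_sh_def zf_word_def zf_class.rep_eq)

lemma ext_zf_word: "zf.ext zf_word P = zf_class P"
  by (simp only: zf_class_eq_ext[of P] zf_word_def[abs_def])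

lemma zf_word_Nil [simp]: "zf_word [] = 1"
  by (simp add: zf_word_def zf_class_one)

lemma zf_class_relation: "P \<in> eds_relations \<Longrightarrow> zf_class P = 0"
  using shuffle.genideal_superset[of eds_relations]
  by (intro zf_class_eq_0) (auto simp: Zf_ideal_def)

lemma zf_word_letter [simp]: "zf_word [x] = 0"
  by (cases x) (auto simp: zf_word_def eds_relations_def intro!: zf_class_relation)

lemma shuffle_replicate:
  "quasi_shuffle shuffle_letters [x] (replicate m x) = scale (of_nat (Suc m)) (word (replicate (Suc m) x))"
  by (induction m) (simp_all add: quasi_shuffle_Cons shuffle_letters_def single_add[symmetric])

text \<open>Shuffling the letter \<open>x\<close> into its own power gives a positive multiple of
  the next power, and the letter itself is zero.\<close>

lemma zf_word_replicate:
  assumes "n > 0"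
  shows "zf_word (replicate n x) = 0"
proof -
  obtain m where n: "n = Suc m" using assms by (cases n) auto
  have "zf_word [x] * zf_word (replicate m x) = of_nat (Suc m) * zf_word (replicate (Suc m) x)"
    by (simp only: zf_word_def zf_class_mult[symmetric] qmul_simps shuffle_replicate
        zf_class_scale zf.q_of_nat)
  then have "of_nat (Suc m) * zf_word (replicate (Suc m) x) = of_nat (Suc m) * 0" by simp
  then show ?thesis unfolding n by (rule zf.of_nat_cancel[rotated]) simp
qed

text \<open>Extended by \<open>0\<close> to words containing \<open>b\<^sub>0\<close>, so that stuffle identities become identities for the
  balanced product.\<close>

definition zeta_y :: "nat list \<Rightarrow> zf" where
  "zeta_y v = (if 0 \<in> set v then 0 else zf_word (x_word v))"

definition corr_coeff :: "nat \<Rightarrow> zf" where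
  "corr_coeff n = (if n \<ge> 2 then zf_rat ((- 1) ^ (n - 1) / of_nat n) * zeta_y [n] else 0)"

lemma quasi_shuffle_stuffle_eq_balanced:
  assumes "0 \<notin> set u" "0 \<notin> set v"
  shows "quasi_shuffle stuffle_letters u v = quasi_shuffle balanced_letters u v"
  using assms
  by (induction u v rule: two_list_induct)
    (auto simp: quasi_shuffle_Cons stuffle_letters_def balanced_letters_def)

text \<open>A letter 0 in either word survives in every term, so both sides vanish. Otherwise a
  nonempty \<open>u\<close> starts with a letter at least 2, and this is a double shuffle
  relation.\<close>

lemma zeta_y_mult:
  assumes "u = [] \<or> hd u \<noteq> 1"
  shows "zf.ext zeta_y (quasi_shuffle balanced_letters u v) = zeta_y u * zeta_y v"
proof (cases "0 \<in> set u \<or> 0 \<in> set v")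
  case True
  have "zeta_y w = 0" if "w \<in> Poly_Mapping.keys (quasi_shuffle balanced_letters u v)" for w
  proof -
    have "set w \<inter> {0} \<noteq> {}"
      using that by (rule quasi_shuffle_meets[rotated 2])
        (use True in \<open>auto simp: balanced_letters_def split: if_splits\<close>)
    then show ?thesis by (simp add: zeta_y_def)
  qed
  with True show ?thesis by (auto simp: zf.ext_eq_0 zeta_y_def)
next
  case False
  then have no0: "0 \<notin> set u" "0 \<notin> set v" by auto
  have "zeta_y w = zf_word (x_word w)"
    if "w \<in> Poly_Mapping.keys (quasi_shuffle balanced_letters u v)" for w
  proof -
    have "set w \<inter> {0} = {}"
      using that by (rule quasi_shuffle_avoids[rotated 3])
        (use no0 in \<open>auto simp: balanced_letters_def split: if_splits\<close>)
    then show ?thesis by (simp add: zeta_y_def)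
  qed
  then have "zf.ext zeta_y (quasi_shuffle balanced_letters u v) =
      zf.ext (\<lambda>w. zf_word (x_word w)) (quasi_shuffle stuffle_letters u v)"
    unfolding quasi_shuffle_stuffle_eq_balanced[OF no0] by (rule zf.ext_cong)
  also have "\<dots> = zf_class (lin_ext (\<lambda>v. word (x_word v)) (quasi_shuffle stuffle_letters u v))"
    by (simp add: zf.ext_lin_ext flip: ext_zf_word)
  also have "\<dots> = zf_class (quasi_shuffle shuffle_letters (x_word u) (x_word v))"
  proof -
    have "hd u \<ge> 2" if "u \<noteq> []"
      using that assms no0(1) by (cases u) auto
    then have "zf_class (lin_ext (\<lambda>v. word (x_word v)) (quasi_shuffle stuffle_letters u v)
        - quasi_shuffle shuffle_letters (x_word u) (x_word v)) = 0"
      using no0 by (intro zf_class_relation) (auto simp: eds_relations_def)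
    then show ?thesis by (simp add: zf.ext_diff flip: ext_zf_word)
  qed
  also have "\<dots> = zeta_y u * zeta_y v"
    using no0 zf_class_mult[of "word (x_word u)" "word (x_word v)"] by (simp add: zeta_y_def zf_word_def)
  finally show ?thesis .
qed

interpretation zf: stuffle_regularisation zf_rat zeta_y "zf.exp_coeff corr_coeff"
proof
  fix n :: nat assume n: "n > 0"
  have "x_word (replicate m 1) = replicate m X1" for m
    by (induction m) (simp_all add: x_word_def)
  then show "zeta_y (replicate n 1) = 0"
    using n by (simp add: zeta_y_def zf_word_replicate)
  have corr: "of_nat k * corr_coeff k = (if k \<ge> 2 then (- 1) ^ (k - 1) * zeta_y [k] else 0)" if "k \<ge> 1" for k
  proof -
    have "of_nat k * (zf_rat ((- 1) ^ (k - 1) / of_nat k) * zeta_y [k]) =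
        zf_rat (of_nat k * ((- 1) ^ (k - 1) / of_nat k)) * zeta_y [k]"
      by (simp only: zf.q_mult zf.q_of_nat mult.assoc)
    then show ?thesis
      using that by (simp add: corr_coeff_def zf.q_power zf.q_minus zf.q_1)
  qed
  have "of_nat n * zf.exp_coeff corr_coeff n =
      (\<Sum>k=1..n. (if k \<ge> 2 then (- 1) ^ (k - 1) * zeta_y [k] else 0) * zf.exp_coeff corr_coeff (n - k))"
    unfolding zf.exp_coeff_rec[where c = corr_coeff, OF _ n, unfolded corr_coeff_def[of 0], simplified]
    by (rule sum.cong) (auto simp: corr)
  also have "\<dots> = (\<Sum>k=2..n. (- 1) ^ (k - 1) * zeta_y [k] * zf.exp_coeff corr_coeff (n - k))"
    by (rule sum.mono_neutral_cong_right) auto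
  finally show "of_nat n * zf.exp_coeff corr_coeff n =
      (\<Sum>k=2..n. (- 1) ^ (k - 1) * zeta_y [k] * zf.exp_coeff corr_coeff (n - k))" .
qed (simp_all add: zeta_y_mult zf.exp_coeff_0, simp add: zeta_y_def x_word_def)

abbreviation e_coeff :: "nat \<Rightarrow> zf" where
  "e_coeff \<equiv> zf.exp_coeff corr_coeff"

abbreviation zeta_reg :: "nat list \<Rightarrow> zf" where
  "zeta_reg \<equiv> zf.reg"

lemma zeta_reg_eq_0: "0 \<in> set v \<Longrightarrow> zeta_reg v = 0"
proof -
  assume "0 \<in> set v"
  then have "ones_series e_coeff x * zeta_y y = 0" if "v = x @ y" for x y
  proof (cases "0 \<in> set x")
    case True
    then have "set x \<inter> {a. a \<noteq> 1} \<noteq> {}" by auto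
    then show ?thesis by (simp add: ones_series_eq_0 del: One_nat_def)
  qed (use \<open>0 \<in> set v\<close> that in \<open>simp add: zeta_y_def\<close>)
  then have "zeta_reg v = split_sum (\<lambda>x y. 0) v"
    unfolding zf.reg_def conv_def by (intro split_sum_cong)
  then show ?thesis by simp
qed

section \<open>Identifying the stuffle regularised values with the abstract regularisation\<close>

lemma nc_mult_eq_conv: "nc_mult Zf (\<lambda>u. Rep_zf (s u)) (\<lambda>v. Rep_zf (t v)) w = Rep_zf (conv s t w)"
  unfolding nc_mult_def times_zf.rep_eq[symmetric] conv_def split_sum_def splits_def
  by (simp add: case_prod_unfold Rep_zf_finsum)

text \<open>Series in y_1 alone multiply like power series in one variable.\<close>

lemma conv_ones_series_ones_series:
  "conv (ones_series a) (ones_series b) = ones_series (\<lambda>n. \<Sum>i\<le>n. a i * b (n - i))"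
proof
  show "conv (ones_series a) (ones_series b) w = ones_series (\<lambda>n. \<Sum>i\<le>n. a i * b (n - i)) w" for w
  proof (induction w arbitrary: a)
    case (Cons x w)
    have "conv (\<lambda>u. 0) (ones_series b) w = 0" by (simp add: conv_def)
    moreover have "ones_series (\<lambda>n. f n + g n) w = ones_series f w + ones_series g w" for f g :: "nat \<Rightarrow> 'a"
      by (simp add: ones_series_def)
    moreover have "ones_series (\<lambda>n. c * f n) w = c * ones_series f w" for c and f :: "nat \<Rightarrow> 'a"
      by (simp add: ones_series_def)
    ultimately show ?case
      by (simp add: conv_Cons ones_series_Cons Cons.IH sum.atMost_Suc_shift del: sum.atMost_Suc)
  qed simp
qed

lemma corr_exponent_eq: "corr_exponent v = Rep_zf (ones_series corr_coeff v)"
proof (cases "length v \<ge> 2 \<and> v = replicate (length v) 1")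
  case True
  then have "zeta_single (length v) = Rep_zf (zeta_y [length v])"
    by (simp add: zeta_single_def zeta_sh_eq zeta_y_def x_word_def)
  with True show ?thesis
    by (simp add: corr_exponent_def ones_series_def corr_coeff_def Rep_zf_smult Let_def)
next
  case False
  then show ?thesis
    by (auto simp: corr_exponent_def ones_series_def corr_coeff_def Let_def zero_zf.rep_eq)
qed

lemma nc_power_corr_exponent:
  "nc_power Zf corr_exponent j = (\<lambda>w. Rep_zf (ones_series (\<lambda>n. (Abs_fps corr_coeff ^ j) $ n) w))"
proof (induction j)
  case 0
  show ?case
    by (rule ext) (simp add: nc_one_def ones_series_def one_zf.rep_eq zero_zf.rep_eq)
next
  case (Suc j)
  have "nc_power Zf corr_exponent (Suc j) w =
      Rep_zf (conv (ones_series corr_coeff) (ones_series (\<lambda>n. (Abs_fps corr_coeff ^ j) $ n)) w)" for w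
    by (simp only: nc_power.simps Suc) (simp only: corr_exponent_eq[abs_def] nc_mult_eq_conv)
  then show ?case
    by (simp add: conv_ones_series_ones_series fps_mult_nth atLeast0AtMost fun_eq_iff)
qed

lemma nc_exp_corr_exponent: "nc_exp Zf corr_exponent w = Rep_zf (ones_series e_coeff w)"
proof -
  have "nc_exp Zf corr_exponent w = Rep_zf (\<Sum>j\<le>length w.
      zf_rat (1 / fact j) * ones_series (\<lambda>n. (Abs_fps corr_coeff ^ j) $ n) w)"
    by (simp add: nc_exp_def nc_power_corr_exponent Rep_zf_smult Rep_zf_finsum atLeast0AtMost)
  then show ?thesis by (simp add: ones_series_def zf.exp_coeff_def)
qed

lemma zeta_st_eq:
  assumes "0 \<notin> set v"
  shows "zeta_st v = Rep_zf (zeta_reg v)"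
proof -
  have "zeta_st v = Rep_zf (conv (ones_series e_coeff) (\<lambda>v. zf_word (x_word v)) v)"
    by (simp add: zeta_st_def nc_exp_corr_exponent[abs_def] zeta_sh_eq nc_mult_eq_conv)
  also have "conv (ones_series e_coeff) (\<lambda>v. zf_word (x_word v)) v = zeta_reg v"
    unfolding zf.reg_def conv_def by (rule split_sum_cong) (use assms in \<open>auto simp: zeta_y_def\<close>)
  finally show ?thesis .
qed


section \<open>Reversal and the shuffle product\<close>

definition snoc :: "'a \<Rightarrow> 'a ncpoly \<Rightarrow> 'a ncpoly" where
  "snoc x = lin_ext (\<lambda>w. word (w @ [x]))"

lemma snoc_simps [simp]:
  "snoc x (P + Q) = snoc x P + snoc x Q"
  "snoc x (word w) = word (w @ [x])"
  by (simp_all add: snoc_def)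

lemma snoc_prepend: "snoc x (prepend a P) = prepend a (snoc x P)"
  by (simp add: snoc_def prepend_def lin_ext_compose)

lemma shuffle_Cons:
  "quasi_shuffle shuffle_letters (a # u) (b # v) =
     prepend a (quasi_shuffle shuffle_letters u (b # v))
     + prepend b (quasi_shuffle shuffle_letters (a # u) v)"
  by (simp add: quasi_shuffle_Cons shuffle_letters_def)

lemma shuffle_snoc:
  "quasi_shuffle shuffle_letters (u @ [x]) (v @ [y]) =
     snoc x (quasi_shuffle shuffle_letters u (v @ [y]))
     + snoc y (quasi_shuffle shuffle_letters (u @ [x]) v)"
proof -
  have single: "quasi_shuffle shuffle_letters [x] (v @ [y]) =
      word (v @ [y, x]) + snoc y (quasi_shuffle shuffle_letters [x] v)" for x y :: 'a and v
    by (induction v) (simp_all add: shuffle_Cons snoc_prepend algebra_simps)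
  show ?thesis
  proof (induction u v rule: two_list_induct)
    case (Nil2 a u)
    show ?case
      using single[of y "a # u" x]
      by (simp add: shuffle.quasi_shuffle_commute[of _ "[y]"] add.commute)
  qed (simp_all add: single shuffle_Cons snoc_prepend algebra_simps)
qed

text \<open>Needed because \<open>theta_X_anti\<close> reverses words. Reversal turns the recursion
  on first letters into the one on last letters, \<open>shuffle_snoc\<close>.\<close>

lemma shuffle_rev:
  "lin_ext (\<lambda>w. word (rev w)) (quasi_shuffle shuffle_letters u v) =
     quasi_shuffle shuffle_letters (rev u) (rev v)"
proof (induction u v rule: two_list_induct)
  case (Cons a u b v)
  have "lin_ext (\<lambda>w. word (rev w)) (prepend x P) = snoc x (lin_ext (\<lambda>w. word (rev w)) P)"
    for x :: 'a and P
    by (simp add: prepend_def snoc_def lin_ext_compose)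
  with Cons show ?case
    by (simp add: shuffle_Cons shuffle_snoc)
qed simp_all


section \<open>The evaluation map\<close>

definition x_letter :: "nat \<Rightarrow> xletter" where
  "x_letter i = (if i = 0 then X0 else X1)"

text \<open>The cut-off to 0 lets the defining sum of the map run over all deconcatenations.\<close>

definition zeta_b :: "nat list \<Rightarrow> zf" where
  "zeta_b u = (if set u \<subseteq> {0, 1} then zf_word (rev (map x_letter u)) else 0)"

lemma inj_theta_X_anti: "inj theta_X_anti"
  unfolding theta_X_anti_def
  by (rule injI) (auto simp: inj_map_eq_map inj_on_def split: xletter.splits)

lemma theta_X_anti_x_letter:
  "set u \<subseteq> {0, 1} \<Longrightarrow> theta_X_anti (rev (map x_letter u)) = u"
  by (induction u) (auto simp: theta_X_anti_def x_letter_def rev_map)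

lemma inv_theta_X_anti:
  "set u \<subseteq> {0, 1} \<Longrightarrow> inv_into UNIV theta_X_anti u = rev (map x_letter u)"
  by (rule inv_into_f_eq[OF inj_theta_X_anti UNIV_I theta_X_anti_x_letter])

text \<open>Merging the letters 0 and 1 gives zero or the letter 2, which the cut-off kills; what
  remains of the recursion is the shuffle product.\<close>

lemma (in rat_algebra) ext_balanced_binary:
  assumes "set u \<subseteq> {0, 1}" "set v \<subseteq> {0, 1}"
  shows "ext (\<lambda>w. if set w \<subseteq> {0, 1} then f (map x_letter w) else 0) (quasi_shuffle balanced_letters u v)
    = ext f (quasi_shuffle shuffle_letters (map x_letter u) (map x_letter v))"
  using assms
proof (induction u v arbitrary: f rule: two_list_induct)
  case (Cons a u b v)
  let ?g = "\<lambda>f w. if set w \<subseteq> {0, 1} then f (map x_letter w) else 0 :: 'r"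
  have shift: "ext (?g f) (prepend x P) = ext (?g (\<lambda>w. f (x_letter x # w))) P" if "x \<in> {0, 1}" for f x P
    unfolding ext_prepend by (rule ext_cong) (use that in auto)
  have merge: "ext (?g f) (prepend_opt (balanced_letters a b) P) = 0" for f P
    using Cons.prems by (auto simp: balanced_letters_def ext_prepend)
  show ?case
    using Cons.prems Cons.IH(1)[of "\<lambda>w. f (x_letter a # w)"] Cons.IH(2)[of "\<lambda>w. f (x_letter b # w)"]
    by (simp only: quasi_shuffle_Cons[of balanced_letters] ext_add merge shift list.set insert_subset)
      (simp add: shuffle_Cons ext_prepend)
qed auto

lemma multiplicative_zeta_b: "zf.multiplicative balanced_letters zeta_b"
  unfolding zf.multiplicative_def
proof (intro allI)
  fix u v
  show "zf.ext zeta_b (quasi_shuffle balanced_letters u v) = zeta_b u * zeta_b v"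
  proof (cases "set u \<subseteq> {0, 1} \<and> set v \<subseteq> {0, 1}")
    case True
    let ?u = "map x_letter u" and ?v = "map x_letter v"
    have "zf.ext zeta_b (quasi_shuffle balanced_letters u v) =
        zf.ext (\<lambda>w. zf_word (rev w)) (quasi_shuffle shuffle_letters ?u ?v)"
      using zf.ext_balanced_binary[of u v "\<lambda>w. zf_word (rev w)"] True
      unfolding zeta_b_def[abs_def] by simp
    also have "\<dots> = zf_class (lin_ext (\<lambda>w. word (rev w)) (quasi_shuffle shuffle_letters ?u ?v))"
      by (simp add: zf.ext_lin_ext flip: ext_zf_word)
    also have "\<dots> = zeta_b u * zeta_b v"
      using True zf_class_mult[of "word (rev ?u)" "word (rev ?v)"]
      by (simp add: shuffle_rev zeta_b_def zf_word_def)
    finally show ?thesis .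
  next
    case False
    then obtain i where i: "i \<in> set u \<union> set v" "i \<ge> 2"
      by (force simp: subset_iff)
    \<comment> \<open>Merging never decreases a letter, so a letter at least 2 leaves one in every
      term.\<close>
    have "zeta_b w = 0" if "w \<in> Poly_Mapping.keys (quasi_shuffle balanced_letters u v)" for w
    proof -
      have "set w \<inter> {2..} \<noteq> {}"
        using that by (rule quasi_shuffle_meets[rotated 2])
          (use i in \<open>auto simp: balanced_letters_def split: if_splits\<close>)
      then show ?thesis by (auto simp: zeta_b_def)
    qed
    with False show ?thesis by (auto simp: zf.ext_eq_0 zeta_b_def)
  qed
qed

definition eval_word :: "nat list \<Rightarrow> zf" where
  "eval_word = conv zeta_b zeta_reg"

lemma multiplicative_eval_word: "zf.multiplicative balanced_letters eval_word"
  unfolding eval_word_def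
  by (rule zf.multiplicative_conv[OF multiplicative_zeta_b zf.multiplicative_reg])

text \<open>Splittings outside the index set contribute zero by the cut-offs in
  \<open>zeta_b\<close> and \<open>zeta_reg\<close>.\<close>

lemma Rep_eval_word:
  "Rep_zf (eval_word w) =
     finsum Zf (\<lambda>(u, v). zeta_sh (inv_into UNIV theta_X_anti u) \<otimes>\<^bsub>Zf\<^esub> zeta_st v)
       {(u, v). w = u @ v \<and> set u \<subseteq> {0, 1} \<and> 0 \<notin> set v}" (is "_ = finsum Zf ?F ?A")
proof -
  have "finsum Zf ?F ?A = finsum Zf (\<lambda>x. Rep_zf (zeta_b (fst x) * zeta_reg (snd x))) ?A"
    by (rule Zf.finsum_cong')
      (auto simp: Rep_zf zeta_sh_eq zeta_st_eq inv_theta_X_anti zeta_b_def times_zf.rep_eq)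
  also have "\<dots> = Rep_zf (\<Sum>x\<in>?A. zeta_b (fst x) * zeta_reg (snd x))"
    by (rule Rep_zf_finsum)
  also have "(\<Sum>x\<in>?A. zeta_b (fst x) * zeta_reg (snd x)) = eval_word w"
    unfolding eval_word_def conv_def split_sum_def case_prod_unfold
    by (rule sum.mono_neutral_left)
      (auto simp: splits_def[of w, symmetric] zeta_b_def zeta_reg_eq_0, auto simp: splits_def)
  finally show ?thesis ..
qed

definition eval_hom :: "nat ncpoly \<Rightarrow> zf" where
  "eval_hom = zf.ext eval_word"

lemma eval_hom_add: "eval_hom (P + Q) = eval_hom P + eval_hom Q"
  by (simp add: eval_hom_def)

lemma eval_hom_mult: "eval_hom (qmul balanced_letters P Q) = eval_hom P * eval_hom Q"
  unfolding eval_hom_def by (rule zf.multiplicative_ext[OF multiplicative_eval_word])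


section \<open>Invariance under \<open>\<tau>\<close>\<close>

text \<open>Both sides run over the factorisations of \<open>v\<close> into three consecutive
  words.\<close>

lemma split_sum_coassoc:
  "split_sum (\<lambda>u w. split_sum (\<lambda>x y. F x y w) u) v = split_sum (\<lambda>x u. split_sum (\<lambda>y w. F x y w) u) v"
  by (induction v arbitrary: F) (simp_all add: split_sum_add add.assoc)

lemma split_sum_map:
  "split_sum F (map g w) = split_sum (\<lambda>u v. F (map g u) (map g v)) w"
  by (induction w arbitrary: F) simp_all

lemma split_sum_rev: "split_sum F (rev w) = split_sum (\<lambda>u v. F (rev v) (rev u)) w"
  unfolding split_sum_def case_prod_unfold
  by (rule sum.reindex_bij_witness[where i = "\<lambda>(u, v). (rev v, rev u)" and j = "\<lambda>(u, v). (rev v, rev u)"])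
    (auto simp: splits_def rev_swap)

lemma split_sum_tau_blocks:
  "split_sum F (tau_blocks w) = split_sum (\<lambda>u v. F (tau_blocks v) (tau_blocks u)) w"
  unfolding tau_blocks_def by (simp add: split_sum_rev split_sum_map)

lemma block_word_simps [simp]:
  "block_word [] = []" "block_word ((k, m) # ks) = k # replicate m 0 @ block_word ks"
  "block_word (ks @ ls) = block_word ks @ block_word ls"
  by (simp_all add: block_word_def)

text \<open>A cut inside a block leaves a 0 in the right factor, so only cuts between blocks
  count.\<close>

lemma split_sum_block_word:
  assumes "\<And>u v. 0 \<in> set v \<Longrightarrow> F u v = 0"
    and "\<forall>(k, m)\<in>set ks. k \<ge> 1"
  shows "split_sum F (block_word ks) = split_sum (\<lambda>u v. F (block_word u) (block_word v)) ks"
  using assms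
proof (induction ks arbitrary: F)
  case (Cons p ks)
  obtain k m where p: "p = (k, m)" by force
  have skip: "split_sum G (replicate m 0 @ w) = split_sum (\<lambda>u v. G (replicate m 0 @ u) v) w"
    if "\<And>u v. 0 \<in> set v \<Longrightarrow> G u v = 0" for G :: "nat list \<Rightarrow> nat list \<Rightarrow> 'a" and w
    using that by (induction m arbitrary: G) simp_all
  show ?case
    using Cons by (simp add: p skip)
qed simp

lemma zero_in_block_word: "0 \<in> set (block_word ks) \<longleftrightarrow> (\<exists>(k, m)\<in>set ks. k = 0 \<or> m > 0)"
  by (induction ks) auto

lemma ones_series_block_word:
  "ones_series e (block_word ks) = (if set ks \<subseteq> {(1, 0)} then e (length ks) else 0)"
proof (induction ks arbitrary: e)
  case (Cons p ks)
  then show ?case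
    by (cases p; cases "snd p") (auto simp: ones_series_Cons)
qed simp

lemma tau_blocks_tau_blocks:
  "\<forall>(k, m)\<in>set ks. k \<ge> 1 \<Longrightarrow> tau_blocks (tau_blocks ks) = ks"
  by (induction ks) (auto simp: tau_blocks_def rev_map[symmetric])

lemma ones_series_tau_blocks:
  assumes "\<forall>(k, m)\<in>set ks. k \<ge> 1"
  shows "ones_series e (block_word (tau_blocks ks)) = ones_series e (block_word ks)"
proof -
  have "set (tau_blocks ks) \<subseteq> {(1, 0)} \<longleftrightarrow> set ks \<subseteq> {(1, 0)}"
    using assms by (force simp: tau_blocks_def subset_iff)
  then show ?thesis
    by (simp add: ones_series_block_word tau_blocks_def)
qed

text \<open>Read backwards, a block b_1 b_0^m spells x_0^m x_1, the code of y_(m+1). A block with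
  \<open>k \<ge> 2\<close> makes both sides zero: its letter is outside the binary alphabet, and its
  image under tau contains b_0.\<close>

lemma zeta_b_block_word:
  assumes "\<forall>(k, m)\<in>set ks. k \<ge> 1"
  shows "zeta_b (block_word ks) = zeta_y (block_word (tau_blocks ks))"
proof -
  have binary: "set (block_word ks) \<subseteq> {0, 1} \<longleftrightarrow> (\<forall>(k, m)\<in>set ks. k \<le> 1)" for ks
    by (induction ks) auto
  have zero: "0 \<in> set (block_word (tau_blocks ks)) \<longleftrightarrow> \<not> (\<forall>(k, m)\<in>set ks. k \<le> 1)"
    unfolding zero_in_block_word by (fastforce simp: tau_blocks_def)
  show ?thesis
  proof (cases "\<forall>(k, m)\<in>set ks. k \<le> 1")
    case True
    with assms have "\<forall>(k, m)\<in>set ks. k = 1" by fastforce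
    then have "rev (map x_letter (block_word ks)) = x_word (block_word (tau_blocks ks))"
      by (induction ks) (auto simp: tau_blocks_def x_word_def x_letter_def)
    then show ?thesis unfolding zeta_b_def zeta_y_def binary zero using True by simp
  next
    case False
    then show ?thesis by (simp only: zeta_b_def zeta_y_def binary zero if_False if_True not_False_eq_True)
  qed
qed

text \<open>The three factors come from a decomposition of the sequence of blocks into a part before,
  a run of \<open>b\<^sub>1\<close> and a part after; \<open>\<tau>\<close> exchanges the outer two.\<close>

lemma eval_word_block_word:
  assumes ks: "\<forall>(k, m)\<in>set ks. k \<ge> 1"
  shows "eval_word (block_word ks) = split_sum (\<lambda>u v. zeta_y (block_word (tau_blocks u)) *
    split_sum (\<lambda>x y. ones_series e_coeff (block_word x) * zeta_y (block_word y)) v) ks"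
proof -
  have "eval_word (block_word ks) = split_sum (\<lambda>u v. zeta_b (block_word u) * zeta_reg (block_word v)) ks"
    unfolding eval_word_def conv_def using ks by (intro split_sum_block_word) (simp_all add: zeta_reg_eq_0)
  also have "\<dots> = split_sum (\<lambda>u v. zeta_y (block_word (tau_blocks u)) *
      split_sum (\<lambda>x y. ones_series e_coeff (block_word x) * zeta_y (block_word y)) v) ks"
  proof (rule split_sum_cong)
    fix u v assume "ks = u @ v"
    with ks have u: "\<forall>(k, m)\<in>set u. k \<ge> 1" and v: "\<forall>(k, m)\<in>set v. k \<ge> 1" by auto
    have "zeta_reg (block_word v) =
        split_sum (\<lambda>x y. ones_series e_coeff (block_word x) * zeta_y (block_word y)) v"
      unfolding zf.reg_def conv_def using v
      by (intro split_sum_block_word) (simp_all add: zeta_y_def)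
    then show "zeta_b (block_word u) * zeta_reg (block_word v) = zeta_y (block_word (tau_blocks u)) *
        split_sum (\<lambda>x y. ones_series e_coeff (block_word x) * zeta_y (block_word y)) v"
      by (simp add: zeta_b_block_word[OF u])
  qed
  finally show ?thesis .
qed

text \<open>Reversing the blocks swaps the outer factors, while the middle one sees only copies of
  the fixed block \<open>(1, 0)\<close>.\<close>

lemma eval_word_tau_blocks:
  assumes ks: "\<forall>(k, m)\<in>set ks. k \<ge> 1"
  shows "eval_word (block_word (tau_blocks ks)) = eval_word (block_word ks)"
proof -
  let ?z = "\<lambda>u. zeta_y (block_word u)" and ?o = "\<lambda>u. ones_series e_coeff (block_word u)"
  have "\<forall>(k, m)\<in>set (tau_blocks ks). k \<ge> 1"
    by (auto simp: tau_blocks_def)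
  from eval_word_block_word[OF this]
  have "eval_word (block_word (tau_blocks ks)) = split_sum (\<lambda>u v. ?z (tau_blocks (tau_blocks v)) *
      split_sum (\<lambda>x y. ?o (tau_blocks y) * ?z (tau_blocks x)) u) ks"
    by (simp add: split_sum_tau_blocks)
  also have "\<dots> = split_sum (\<lambda>u v. split_sum (\<lambda>x y. ?z (tau_blocks x) * (?o y * ?z v)) u) ks"
  proof (rule split_sum_cong)
    fix u v assume "ks = u @ v"
    with ks have u: "\<forall>(k, m)\<in>set u. k \<ge> 1" and v: "\<forall>(k, m)\<in>set v. k \<ge> 1" by auto
    have "?z v * (?o (tau_blocks y) * ?z (tau_blocks x)) = ?z (tau_blocks x) * (?o y * ?z v)"
      if "u = x @ y" for x y
      using that u by (subst ones_series_tau_blocks) (auto simp: ac_simps)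
    then show "?z (tau_blocks (tau_blocks v)) * split_sum (\<lambda>x y. ?o (tau_blocks y) * ?z (tau_blocks x)) u
        = split_sum (\<lambda>x y. ?z (tau_blocks x) * (?o y * ?z v)) u"
      unfolding tau_blocks_tau_blocks[OF v] split_sum_mult_left[symmetric] by (rule split_sum_cong)
  qed
  \<comment> \<open>The reversed triple sum is bracketed the other way; coassociativity restores the
    original form.\<close>
  also have "\<dots> = eval_word (block_word ks)"
    by (simp add: split_sum_coassoc[of "\<lambda>x y v. ?z (tau_blocks x) * (?o y * ?z v)"]
        split_sum_mult_left eval_word_block_word[OF ks])
  finally show ?thesis .
qed


section \<open>Surjectivity\<close>

text \<open>A cut before the end of \<open>u\<close> leaves its last letter 0 in the right
  factor.\<close>

lemma split_sum_after_zero: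
  assumes "\<And>u v. 0 \<in> set v \<Longrightarrow> F u v = 0" and "u = [] \<or> last u = (0 :: nat)"
  shows "split_sum F (u @ w) = split_sum (\<lambda>x y. F (u @ x) y) w"
  using assms
proof (induction u arbitrary: F)
  case (Cons a u)
  then have "0 \<in> set (a # u)" "u = [] \<or> last u = 0"
    by (auto split: if_splits dest: last_in_set)
  then have "F [] (a # u @ w) = 0" using Cons.prems(1)[of "a # u @ w" "[]"] by auto
  then show ?case
    using Cons.IH[of "\<lambda>u. F (a # u)"] Cons.prems(1) \<open>u = [] \<or> last u = 0\<close> by simp
qed simp

lemma split_sum_replicate:
  "split_sum F (replicate n a) = (\<Sum>i\<le>n. F (replicate i a) (replicate (n - i) a))"
  by (induction n arbitrary: F) (simp_all add: sum.atMost_Suc_shift del: sum.atMost_Suc)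

lemma eval_word_append_ones:
  assumes "u = [] \<or> last u = 0"
  shows "eval_word (u @ replicate n 1) = (\<Sum>i\<le>n. zeta_b (u @ replicate i 1) * e_coeff (n - i))"
  unfolding eval_word_def conv_def using assms
  by (subst split_sum_after_zero) (simp_all add: zeta_reg_eq_0 split_sum_replicate zf.reg_ones[unfolded One_nat_def])

text \<open>This is the value at b_1^n: nonempty powers of x_1 have shuffle value zero, so only the
  empty prefix contributes.\<close>

lemma e_coeff_in_range: "e_coeff n \<in> range eval_hom"
proof -
  have "zeta_b (replicate i 1) = (if i = 0 then 1 else 0)" for i
    by (auto simp: zeta_b_def x_letter_def zf_word_replicate)
  moreover have "(\<Sum>i\<le>n. (if i = 0 then 1 else 0) * e_coeff (n - i)) =
      (\<Sum>i\<le>n. if i = 0 then e_coeff n else 0)"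
    by (rule sum.cong) auto
  ultimately have "eval_word (replicate n 1) = e_coeff n"
    using eval_word_append_ones[of "[]" n] by simp
  then have "eval_hom (word (replicate n 1)) = e_coeff n"
    by (simp add: eval_hom_def)
  then show ?thesis by (metis rangeI)
qed

lemma zeta_b_in_range:
  assumes "u = [] \<or> last u = 0"
  shows "zeta_b (u @ replicate n 1) \<in> range eval_hom"
proof (induction n rule: less_induct)
  case (less n)
  have sum: "(\<Sum>i\<in>A. f i) \<in> range eval_hom" if "\<And>i. i \<in> A \<Longrightarrow> f i \<in> range eval_hom" for A and f :: "nat \<Rightarrow> zf"
    using that
  proof (induction A rule: infinite_finite_induct)
    case (insert x A)
    then obtain P Q where "f x = eval_hom P" "sum f A = eval_hom Q" by blast
    with insert show ?case by (auto simp: eval_hom_def simp flip: zf.ext_add)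
  qed (use rangeI[of eval_hom 0] in \<open>auto simp: eval_hom_def\<close>)
  have "zeta_b (u @ replicate i 1) * e_coeff (n - i) \<in> range eval_hom" if i: "i < n" for i
  proof -
    obtain P Q where "zeta_b (u @ replicate i 1) = eval_hom P" "e_coeff (n - i) = eval_hom Q"
      using less[OF i] e_coeff_in_range[of "n - i"] by blast
    then show ?thesis by (simp flip: eval_hom_mult)
  qed
  then have "(\<Sum>i<n. zeta_b (u @ replicate i 1) * e_coeff (n - i)) \<in> range eval_hom"
    by (intro sum) simp
  then obtain P where P: "(\<Sum>i<n. zeta_b (u @ replicate i 1) * e_coeff (n - i)) = eval_hom P" by blast
  \<comment> \<open>The term \<open>i = n\<close> carries \<open>e_coeff 0\<close>, which is 1, so
    the expansion can be solved for it.\<close>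
  have "zeta_b (u @ replicate n 1) = eval_word (u @ replicate n 1) - eval_hom P"
    unfolding eval_word_append_ones[OF assms] P[symmetric] lessThan_Suc_atMost[symmetric]
    by (simp add: zf.exp_coeff_0)
  also have "\<dots> = eval_hom (word (u @ replicate n 1) - P)"
    by (simp add: eval_hom_def zf.ext_diff)
  finally show ?case by blast
qed

lemma surj_eval_hom: "surj eval_hom"
proof -
  \<comment> \<open>The maximal trailing run of b_1 is split off, leaving a word that is empty or
    ends in b_0.\<close>
  have split: "\<exists>u n. (u = [] \<or> last u = 0) \<and> v = u @ replicate n 1" if "set v \<subseteq> {0, 1}" for v :: "nat list"
    using that
  proof (induction v rule: rev_induct)
    case (snoc x v)
    show ?case
    proof (cases "x = 0")
      case True
      then show ?thesis by (intro exI[of _ "v @ [x]"] exI[of _ 0]) auto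
    next
      case False
      with snoc obtain u n where "u = [] \<or> last u = 0" "v = u @ replicate n 1" "x = 1" by auto
      then show ?thesis
        by (intro exI[of _ u] exI[of _ "Suc n"]) (auto simp: replicate_append_same)
    qed
  qed auto
  have words: "zf_word w \<in> range eval_hom" for w
  proof -
    have sub: "set (theta_X_anti w) \<subseteq> {0, 1}"
      by (auto simp: theta_X_anti_def split: xletter.splits)
    have "rev (map x_letter (theta_X_anti w)) = w"
      by (induction w) (auto simp: theta_X_anti_def x_letter_def rev_map split: xletter.splits)
    then have "zf_word w = zeta_b (theta_X_anti w)"
      using sub by (simp add: zeta_b_def)
    then show ?thesis using split[OF sub] zeta_b_in_range by metis
  qed
  have "zf_class P \<in> range eval_hom" for P
  proof (induction P rule: ncpoly_induct)
    case (word w)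
    show ?case using words[of w] by (simp add: zf_word_def)
  next
    case (add P Q)
    then obtain P' Q' where "zf_class P = eval_hom P'" "zf_class Q = eval_hom Q'" by blast
    then have "zf_class (P + Q) = eval_hom (P' + Q')" by (simp add: zf_class_add eval_hom_def)
    then show ?case by blast
  next
    case (scale c P)
    then obtain P' where "zf_class P = eval_hom P'" by blast
    then have "zf_class (scale c P) = eval_hom (scale c P')" by (simp add: zf_class_scale eval_hom_def)
    then show ?case by blast
  qed
  then have "x \<in> range eval_hom" for x using zf_class_surj[of x] by metis
  then show ?thesis by auto
qed


section \<open>The morphism on the quotient\<close>

lemma eval_hom_Gf_ideal: "P \<in> Gf_ideal \<Longrightarrow> eval_hom P = 0"
proof -
  have "Gf_ideal \<subseteq> {P. eval_hom P = 0}"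
    unfolding Gf_ideal_def
  proof (rule balanced.genideal_subsetI)
    \<comment> \<open>Both deconcatenations vanish: the letter x_0 is a relation, and
      \<open>zeta_reg\<close> is zero on words containing 0.\<close>
    have "eval_hom (word [0]) = 0"
      by (simp add: eval_hom_def eval_word_def conv_def zeta_reg_eq_0 zeta_b_def)
    moreover have "eval_hom P = 0" if "P \<in> tau_relations" for P
      using that by (auto simp: tau_relations_def eval_hom_def zf.ext_diff eval_word_tau_blocks)
    ultimately show "insert (word [0]) tau_relations \<subseteq> {P. eval_hom P = 0}" by auto
  qed (simp_all add: eval_hom_mult, simp_all add: eval_hom_def)
  then show "P \<in> Gf_ideal \<Longrightarrow> eval_hom P = 0" by blast
qed

text \<open>Evaluates at an arbitrary representative; the choice does not matter because
  \<open>eval_hom\<close> kills \<open>Gf_ideal\<close>.\<close>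

definition eval_Gf :: "nat ncpoly set \<Rightarrow> xletter ncpoly set" where
  "eval_Gf S = Rep_zf (eval_hom (SOME P. P \<in> S))"

lemma eval_Gf_coset: "eval_Gf (Gf_ideal +>\<^bsub>balanced_algebra\<^esub> P) = Rep_zf (eval_hom P)"
proof -
  let ?S = "Gf_ideal +>\<^bsub>balanced_algebra\<^esub> P"
  have "P \<in> ?S"
    by (rule coset_self[OF balanced.algebra_qsh_algebra ideal_Gf]) simp
  then have "(SOME Q. Q \<in> ?S) \<in> ?S" by (rule someI)
  then obtain H where "H \<in> Gf_ideal" "(SOME Q. Q \<in> ?S) = H + P"
    by (auto simp: a_r_coset_def')
  then show ?thesis
    using eval_hom_Gf_ideal[of H] by (simp add: eval_Gf_def eval_hom_def)
qed

lemma algebra_morphism_eval_Gf: "algebra_morphism QQ Gf Zf eval_Gf"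
  unfolding algebra_morphism_def
proof (intro conjI ballI algebra_Gf algebra_Zf ring_hom_memI)
  show "eval_Gf \<one>\<^bsub>Gf\<^esub> = \<one>\<^bsub>Zf\<^esub>"
    by (simp add: Gf_simps eval_Gf_coset eval_hom_def eval_word_def zeta_b_def zf.reg_def zeta_y_def
        x_word_def zf.exp_coeff_0 one_zf.rep_eq)
next
  fix c :: rat and S assume "S \<in> carrier Gf"
  then obtain P where S: "S = Gf_ideal +>\<^bsub>balanced_algebra\<^esub> P" by (auto simp: Gf_simps)
  have "eval_hom (scale c P) = zf_rat c * eval_hom P" by (simp add: eval_hom_def)
  then show "eval_Gf (c \<odot>\<^bsub>Gf\<^esub> S) = c \<odot>\<^bsub>Zf\<^esub> eval_Gf S"
    by (simp add: S Gf_simps eval_Gf_coset Rep_zf_smult)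
qed (auto simp: Gf_simps eval_Gf_coset Rep_zf eval_hom_mult times_zf.rep_eq eval_hom_add plus_zf.rep_eq)

theorem theorem7p4:
  shows "\<exists>p :: nat ncpoly set \<Rightarrow> xletter ncpoly set.
    algebra_morphism QQ Gf Zf p \<and>
    p ` carrier Gf = carrier Zf \<and>
    (\<forall>w :: nat list.
       p (f_class w) =
         finsum Zf (\<lambda>(u, v). zeta_sh (inv_into UNIV theta_X_anti u) \<otimes>\<^bsub>Zf\<^esub> zeta_st v)
           {(u, v). w = u @ v \<and> set u \<subseteq> {0, 1} \<and> 0 \<notin> set v})"
proof (intro exI conjI allI)
  show "algebra_morphism QQ Gf Zf eval_Gf"
    by (rule algebra_morphism_eval_Gf)
  have "eval_Gf ` carrier Gf = range (\<lambda>P. Rep_zf (eval_hom P))"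
    by (simp add: Gf_simps image_image eval_Gf_coset)
  also have "\<dots> = Rep_zf ` range eval_hom"
    by (simp add: image_image)
  also have "\<dots> = carrier Zf"
    using surj_eval_hom type_definition.Rep_range[OF type_definition_zf] by simp
  finally show "eval_Gf ` carrier Gf = carrier Zf" .
  show "eval_Gf (f_class w) =
      finsum Zf (\<lambda>(u, v). zeta_sh (inv_into UNIV theta_X_anti u) \<otimes>\<^bsub>Zf\<^esub> zeta_st v)
        {(u, v). w = u @ v \<and> set u \<subseteq> {0, 1} \<and> 0 \<notin> set v}" for w
    by (simp only: f_class_def eval_Gf_coset eval_hom_def zf.ext_word Rep_eval_word)
qed

end
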